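(* Let $T:X\to X$ be a continuous map of a compact metric space $(X,d)$ such that $(X,T)$ has the almost specification property. Then for any continuous functions $\varphi_1,\varphi_2:X\to\mathbb{R}$, either $R_{\varphi_1}\cap I_{\varphi_2}=\emptyset$ or $R_{\varphi_1}\cap I_{\varphi_2}$ has full entropy, i.e. $h_{\mathrm{top}}(T,R_{\varphi_1}\cap I_{\varphi_2})=h_{\mathrm{top}}(T)$, where $h_{\mathrm{top}}(T)=h_{\mathrm{top}}(T,X)$.
   Context: Regular and irregular sets. For continuous $\varphi:X\to\mathbb{R}$ put $\underline{\varphi}(x)=\liminf_{n\to\infty}\frac1n\sum_{i=0}^{n-1}\varphi(T^ix)$ and $\overline{\varphi}(x)=\limsup_{n\to\infty}\frac1n\sum_{i=0}^{n-1}\varphi(T^ix)$. $R_\varphi=\{x\in X:\underline{\varphi}(x)=\overline{\varphi}(x)\}$ is the set of $\varphi$-regular points and $I_\varphi=\{x\in X:\underline{\varphi}(x)<\overline{\varphi}(x)\}$ is the set of $\varphi$-irregular points. Almost specification. A mistake function is a map $g:\mathbb{N}\times(0,\varepsilon_0]\to\mathbb{N}$ (for some $\varepsilon_0>0$) such that for every $\varepsilon$ and $n$, $g(n,\varepsilon)\le g(n+1,\varepsilon)$ and $\lim_{n\to\infty} g(n,\varepsilon)/n=0$; for $\varepsilon\ge\varepsilon_0$ set $g(n,\varepsilon)=g(n,\varepsilon_0)$. When $g(n,\varepsilon)<n$, let $B_n(g;x,\varepsilon)$ be the set of $y\in X$ for which there is $\Lambda\subset\{0,1,\dots,n-1\}$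 with $|\Lambda|\ge n-g(n,\varepsilon)$ and $\max_{j\in\Lambda}d(T^jx,T^jy)<\varepsilon$. $(X,T)$ has the almost specification property (with mistake function $g$) if there is a function $k_g:(0,\infty)\to\mathbb{N}$ (with $g(n,\varepsilon)<n$ for $n\ge k_g(\varepsilon)$) such that for any $m\ge1$, any $\varepsilon_1,\dots,\varepsilon_m>0$, any $x_1,\dots,x_m\in X$ and any integers $n_j\ge k_g(\varepsilon_j)$, $j=1,\dots,m$, there is $z\in X$ with $T^{l_j}z\in B_{n_j}(g;x_j,\varepsilon_j)$ for $j=1,\dots,m$, where $n_0=0$ and $l_j=\sum_{s=0}^{j-1}n_s$. Bowen's topological entropy of a (not necessarily compact or invariant) set $Z\subset X$. Let $B_n(T,x,\varepsilon)=\{y\in X:d(T^ix,T^iy)<\varepsilon,\ 0\le i\le n-1\}$. For $s\in\mathbb{R}$, $\varepsilon>0$, $N\in\mathbb{N}$ let $C(Z;s,\varepsilon,N)=\inf\sum_i e^{-sn_i}$, the infimum over all finite or countable families $\{B_{n_i}(T,x_i,\varepsilon)\}_i$ covering $Z$ with $x_i\in X$ and all $n_i\ge N$. Let $C(Z;s,\varepsilon)=\lim_{N\to\infty}C(Z;s,\varepsilon,N)$, $h_{\mathrm{top}}(T,Z;\varepsilon)=\inf\{s:C(Z;s,\varepsilon)=0\}$ and $h_{\mathrm{top}}(T,Z)=\lim_{\varepsilon\to0}h_{\mathrm{top}}(T,Z;\varepsilon)$. *)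

theory Defs
  imports "HOL-Analysis.Analysis"
begin

text \<open>The space \<open>X\<close> is a type \<open>'a::metric_space\<close>; its compactness is assumed where it is needed.\<close>

section \<open>Regular and irregular points\<close>

definition birkhoff_avg :: "('a \<Rightarrow> 'a) \<Rightarrow> ('a \<Rightarrow> real) \<Rightarrow> nat \<Rightarrow> 'a \<Rightarrow> real" where
  "birkhoff_avg T \<phi> n x = (1 / real n) * (\<Sum>i<n. \<phi> ((T ^^ i) x))"

text \<open>Limits inferior and superior are taken in the extended reals.\<close>

definition lower_avg :: "('a \<Rightarrow> 'a) \<Rightarrow> ('a \<Rightarrow> real) \<Rightarrow> 'a \<Rightarrow> ereal" where
  "lower_avg T \<phi> x = liminf (\<lambda>n. ereal (birkhoff_avg T \<phi> n x))"

definition upper_avg :: "('a \<Rightarrow> 'a) \<Rightarrow> ('a \<Rightarrow> real) \<Rightarrow> 'a \<Rightarrow> ereal" where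
  "upper_avg T \<phi> x = limsup (\<lambda>n. ereal (birkhoff_avg T \<phi> n x))"

definition regular_set :: "('a \<Rightarrow> 'a) \<Rightarrow> ('a \<Rightarrow> real) \<Rightarrow> 'a set" where
  "regular_set T \<phi> = {x. lower_avg T \<phi> x = upper_avg T \<phi> x}"

definition irregular_set :: "('a \<Rightarrow> 'a) \<Rightarrow> ('a \<Rightarrow> real) \<Rightarrow> 'a set" where
  "irregular_set T \<phi> = {x. lower_avg T \<phi> x < upper_avg T \<phi> x}"

section \<open>Almost specification\<close>

text \<open>A mistake function on \<open>{0<..\<epsilon>\<^sub>0}\<close>, already extended by its value at \<open>\<epsilon>\<^sub>0\<close> to all
  larger \<open>\<epsilon>\<close>. Its values at \<open>\<epsilon> \<le> 0\<close> are irrelevant.\<close>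

definition mistake_function :: "real \<Rightarrow> (nat \<Rightarrow> real \<Rightarrow> nat) \<Rightarrow> bool" where
  "mistake_function \<epsilon>\<^sub>0 g \<longleftrightarrow>
     \<epsilon>\<^sub>0 > 0 \<and>
     (\<forall>\<epsilon>\<in>{0<..\<epsilon>\<^sub>0}. (\<forall>n. g n \<epsilon> \<le> g (Suc n) \<epsilon>) \<and> (\<lambda>n. real (g n \<epsilon>) / real n) \<longlonglongrightarrow> 0) \<and>
     (\<forall>\<epsilon>\<ge>\<epsilon>\<^sub>0. \<forall>n. g n \<epsilon> = g n \<epsilon>\<^sub>0)"

text \<open>Only meaningful (and only used) when \<open>g n \<epsilon> < n\<close>; then the subtraction does not truncate
  and \<open>\<Lambda>\<close> is nonempty, so that the bound on the maximum over \<open>\<Lambda>\<close> is the bound on each term.\<close>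

definition mistake_ball ::
  "('a::metric_space \<Rightarrow> 'a) \<Rightarrow> (nat \<Rightarrow> real \<Rightarrow> nat) \<Rightarrow> nat \<Rightarrow> 'a \<Rightarrow> real \<Rightarrow> 'a set" where
  "mistake_ball T g n x \<epsilon> =
     {y. \<exists>\<Lambda>\<subseteq>{..<n}. card \<Lambda> \<ge> n - g n \<epsilon> \<and> (\<forall>j\<in>\<Lambda>. dist ((T ^^ j) x) ((T ^^ j) y) < \<epsilon>)}"

definition almost_specification_with ::
  "('a::metric_space \<Rightarrow> 'a) \<Rightarrow> (nat \<Rightarrow> real \<Rightarrow> nat) \<Rightarrow> bool" where
  "almost_specification_with T g \<longleftrightarrow>
     (\<exists>k :: real \<Rightarrow> nat.
        (\<forall>\<epsilon>>0. \<forall>n\<ge>k \<epsilon>. g n \<epsilon> < n) \<and>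
        (\<forall>m\<ge>1. \<forall>(\<epsilon> :: nat \<Rightarrow> real) (x :: nat \<Rightarrow> 'a) (n :: nat \<Rightarrow> nat).
           (\<forall>j\<in>{1..m}. \<epsilon> j > 0 \<and> n j \<ge> k (\<epsilon> j)) \<longrightarrow>
           (\<exists>z. \<forall>j\<in>{1..m}. (T ^^ (\<Sum>s=1..<j. n s)) z \<in> mistake_ball T g (n j) (x j) (\<epsilon> j))))"

definition almost_specification :: "('a::metric_space \<Rightarrow> 'a) \<Rightarrow> bool" where
  "almost_specification T \<longleftrightarrow>
     (\<exists>\<epsilon>\<^sub>0 g. mistake_function \<epsilon>\<^sub>0 g \<and> almost_specification_with T g)"

section \<open>Bowen's topological entropy\<close>

definition bowen_ball :: "('a::metric_space \<Rightarrow> 'a) \<Rightarrow> nat \<Rightarrow> 'a \<Rightarrow> real \<Rightarrow> 'a set" where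
  "bowen_ball T n x \<epsilon> = {y. \<forall>i<n. dist ((T ^^ i) x) ((T ^^ i) y) < \<epsilon>}"

text \<open>Finite or countable families are indexed by an arbitrary set \<open>I\<close> of naturals.\<close>

definition bowen_cover ::
  "('a::metric_space \<Rightarrow> 'a) \<Rightarrow> 'a set \<Rightarrow> real \<Rightarrow> nat \<Rightarrow> nat set \<Rightarrow> (nat \<Rightarrow> 'a) \<Rightarrow> (nat \<Rightarrow> nat) \<Rightarrow> bool" where
  "bowen_cover T Z \<epsilon> N I x n \<longleftrightarrow>
     (\<forall>i\<in>I. n i \<ge> N) \<and> Z \<subseteq> (\<Union>i\<in>I. bowen_ball T (n i) (x i) \<epsilon>)"

definition bowen_C_at ::
  "('a::metric_space \<Rightarrow> 'a) \<Rightarrow> 'a set \<Rightarrow> real \<Rightarrow> real \<Rightarrow> nat \<Rightarrow> ennreal" where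
  "bowen_C_at T Z s \<epsilon> N =
     Inf {(\<Sum>\<^sub>\<infinity>i\<in>I. ennreal (exp (- s * real (n i)))) | I x n. bowen_cover T Z \<epsilon> N I x n}"

definition bowen_C :: "('a::metric_space \<Rightarrow> 'a) \<Rightarrow> 'a set \<Rightarrow> real \<Rightarrow> real \<Rightarrow> ennreal" where
  "bowen_C T Z s \<epsilon> = lim (\<lambda>N. bowen_C_at T Z s \<epsilon> N)"

definition entropy_at :: "('a::metric_space \<Rightarrow> 'a) \<Rightarrow> 'a set \<Rightarrow> real \<Rightarrow> ereal" where
  "entropy_at T Z \<epsilon> = Inf (ereal ` {s. bowen_C T Z s \<epsilon> = 0})"

text \<open>The limits in \<open>N\<close> and \<open>\<epsilon>\<close> exist because \<open>bowen_C_at\<close> is increasing in \<open>N\<close> and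
  \<open>entropy_at\<close> is decreasing in \<open>\<epsilon>\<close>. The entropy may be infinite.\<close>

definition top_entropy :: "('a::metric_space \<Rightarrow> 'a) \<Rightarrow> 'a set \<Rightarrow> ereal" where
  "top_entropy T Z = Lim (at_right 0) (\<lambda>\<epsilon>. entropy_at T Z \<epsilon>)"

end

theory Submission
  imports Defs "HOL-Probability.Infinite_Product_Measure" "HOL-Real_Asymp.Real_Asymp"
begin

text \<open>Let \<open>x\<^sub>0\<close> be a point that is regular for \<open>\<phi>\<^sub>1\<close> and irregular for \<open>\<phi>\<^sub>2\<close>. Its averages of the pair \<open>\<Phi> = (\<phi>\<^sub>1, \<phi>\<^sub>2)\<close> accumulate at two vectors \<open>(a, b)\<close>
and \<open>(a, b')\<close> with \<open>b \<noteq> b'\<close>. Points that imitate, for most of the time, one of exponentially many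
separated orbit segments, and for a small fixed proportion of the time the orbit of \<open>x\<^sub>0\<close>, carry almost
all the entropy. If the segments have nearly equal averages of \<open>\<Phi>\<close>, and if the pieces of the orbit of
\<open>x\<^sub>0\<close> are taken near \<open>(a, b)\<close> during some long stages and near \<open>(a, b')\<close> during others, then the averages
of \<open>\<phi>\<^sub>1\<close> converge while those of \<open>\<phi>\<^sub>2\<close> oscillate. The proof carries this out by counting alone; no
invariant measure is used.

The bookkeeping is done by the predicate \<open>rich\<close>: for arbitrarily long times \<open>n\<close> there are
\<open>exp (h * n)\<close> orbit segments of length \<open>n\<close> that are pairwise far apart at more than \<open>\<beta> * n\<close> times and
whose averages of \<open>\<Phi>\<close> are all close to a given vector \<open>v\<close>. It is obtained and improved in four steps.
If the entropy of the space exceeds \<open>h\<close>, there are \<open>exp (h * n)\<close> segments that differ at least once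
(\<open>entropy_imp_spread\<close>), and by compactness of the set of possible averages a pigeonhole argument makes
their averages nearly equal (\<open>rich_exists\<close>). Almost specification changes a small proportion of
every segment, so separation at a single time could be lost; but only subexponentially many segments
agree with a given one up to a tiny proportion of times, so at an arbitrarily small cost in \<open>h\<close> the
segments differ at a positive proportion of times (\<open>rich_thin\<close>). Concatenating such segments with
pieces of the orbit of \<open>x\<^sub>0\<close> gives segments with averages near a proper mixture of \<open>v\<close> and \<open>(a, b)\<close>, or
of \<open>v\<close> and \<open>(a, b')\<close> (\<open>rich_mix\<close>), which are thinned once more.

Finally, infinitely many of these mixed segments are concatenated in stages (\<open>stage_schedule\<close>), with
tracing errors tending to zero. A single block is short compared with the time before it, which gives
convergence for \<open>\<phi>\<^sub>1\<close> (\<open>averages_converge_of_blocks\<close>), while a whole stage is long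
compared with the time before it, which gives oscillation for \<open>\<phi>\<^sub>2\<close> (\<open>averages_at_stage_ends\<close>).
The choice of a segment for each block parametrises the points so constructed by an infinite
product of finite sets. A Bowen ball of length \<open>n\<close> only contains points with the same choices in all
blocks completed by time \<open>n\<close>, that is, points of one cylinder, whose product measure is about
\<open>exp (- h * n)\<close>.
As a countable cover by cylinders has total measure at least one, Bowen's covering sums stay bounded away
from zero (\<open>bowen_C_nonzero_of_blocks\<close>).\<close>

section \<open>Orbit segments up to a small proportion of errors\<close>

definition deviations :: "('a::metric_space \<Rightarrow> 'a) \<Rightarrow> nat \<Rightarrow> real \<Rightarrow> 'a \<Rightarrow> 'a \<Rightarrow> nat" where
  "deviations T n \<epsilon> x y = card {i. i < n \<and> dist ((T ^^ i) x) ((T ^^ i) y) > \<epsilon>}"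

text \<open>The parameter \<open>\<epsilon>\<close> bounds both the distance and the proportion of exceptional times. In this form no
mistake function appears in the later arguments.\<close>
definition tracks :: "('a::metric_space \<Rightarrow> 'a) \<Rightarrow> nat \<Rightarrow> real \<Rightarrow> 'a \<Rightarrow> 'a \<Rightarrow> bool" where
  "tracks T n \<epsilon> x y \<longleftrightarrow> real (deviations T n \<epsilon> x y) \<le> \<epsilon> * real n"

text \<open>For \<open>k = 0\<close> this says that \<open>E\<close> is \<open>(n, \<delta>)\<close>-separated.\<close>
definition spread :: "('a::metric_space \<Rightarrow> 'a) \<Rightarrow> nat \<Rightarrow> real \<Rightarrow> real \<Rightarrow> 'a set \<Rightarrow> bool" where
  "spread T n \<delta> k E \<longleftrightarrow> (\<forall>x\<in>E. \<forall>y\<in>E. x \<noteq> y \<longrightarrow> k < real (deviations T n \<delta> x y))"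

definition orbit_sum :: "('a \<Rightarrow> 'a) \<Rightarrow> ('a \<Rightarrow> 'b::real_normed_vector) \<Rightarrow> nat \<Rightarrow> 'a \<Rightarrow> 'b" where
  "orbit_sum T \<Phi> n x = (\<Sum>i<n. \<Phi> ((T ^^ i) x))"

text \<open>The orbit sums are compared with \<open>n v\<close>, so the last condition bounds the distance of the average from
\<open>v\<close> by \<open>\<eta>\<close>. Richness with large \<open>h\<close> is a lower bound for the entropy that orbits with average \<open>v\<close> carry.\<close>
definition rich ::
  "('a::metric_space \<Rightarrow> 'a) \<Rightarrow> ('a \<Rightarrow> 'b::real_normed_vector) \<Rightarrow> real \<Rightarrow> real \<Rightarrow> real \<Rightarrow> 'b \<Rightarrow> bool" where
  "rich T \<Phi> \<delta> \<beta> h v \<longleftrightarrow>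
     (\<forall>\<eta>>0. \<forall>N. \<exists>n\<ge>N. \<exists>E. finite E \<and> exp (h * real n) \<le> real (card E) \<and>
        spread T n \<delta> (\<beta> * real n) E \<and>
        (\<forall>x\<in>E. norm (orbit_sum T \<Phi> n x - real n *\<^sub>R v) \<le> \<eta> * real n))"

lemma deviations_commute: "deviations T n \<epsilon> x y = deviations T n \<epsilon> y x"
  by (simp add: deviations_def dist_commute)

lemma deviations_eq_0: "deviations T n \<epsilon> x y = 0 \<longleftrightarrow> (\<forall>i<n. dist ((T ^^ i) x) ((T ^^ i) y) \<le> \<epsilon>)"
  by (auto simp: deviations_def not_less[symmetric])

lemma deviations_self: "\<epsilon> \<ge> 0 \<Longrightarrow> deviations T n \<epsilon> x x = 0"
  by (simp add: deviations_eq_0)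

lemma funpow_shift: "(T ^^ i) ((T ^^ l) z) = (T ^^ (l + i)) z"
  by (metis add.commute comp_apply funpow_add)

lemma orbit_sum_add: "orbit_sum T \<Phi> (m + n) z = orbit_sum T \<Phi> m z + orbit_sum T \<Phi> n ((T ^^ m) z)"
  unfolding orbit_sum_def
  by (induction n) (simp_all add: funpow_shift add.assoc)

lemma orbit_sum_bound:
  assumes "\<And>x. norm (\<Phi> x) \<le> M"
  shows "norm (orbit_sum T \<Phi> n x) \<le> M * real n"
  unfolding orbit_sum_def using sum_norm_bound[of "{..<n}" "\<lambda>i. \<Phi> ((T ^^ i) x)" M] assms
  by (simp add: mult.commute)

lemma orbit_sum_blocks:
  fixes J :: nat
  assumes "\<And>j. j < J \<Longrightarrow>
      norm (orbit_sum T \<Phi> (n j) ((T ^^ (\<Sum>i<j. n i)) z) - real (n j) *\<^sub>R t j) \<le> real (n j) * \<theta> j"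
  shows "norm (orbit_sum T \<Phi> (\<Sum>i<J. n i) z - (\<Sum>j<J. real (n j) *\<^sub>R t j)) \<le> (\<Sum>j<J. real (n j) * \<theta> j)"
  using assms
proof (induction J)
  case 0
  then show ?case by (simp add: orbit_sum_def)
next
  case (Suc J)
  have "norm (orbit_sum T \<Phi> (\<Sum>i<Suc J. n i) z - (\<Sum>j<Suc J. real (n j) *\<^sub>R t j))
      = norm ((orbit_sum T \<Phi> (\<Sum>i<J. n i) z - (\<Sum>j<J. real (n j) *\<^sub>R t j))
          + (orbit_sum T \<Phi> (n J) ((T ^^ (\<Sum>i<J. n i)) z) - real (n J) *\<^sub>R t J))"
    using orbit_sum_add[of T \<Phi> "\<Sum>i<J. n i" "n J" z] by (simp add: add_diff_add)
  also have "\<dots> \<le> (\<Sum>j<J. real (n j) * \<theta> j) + real (n J) * \<theta> J"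
    using Suc.prems by (intro norm_triangle_mono Suc.IH) auto
  finally show ?case by simp
qed

text \<open>At the times when the two orbits are close, uniform continuity applies; the other times are so few that
the crude bound by twice the maximum of \<open>\<Phi>\<close> does no harm. The same \<open>\<epsilon>\<close> serves every length \<open>n\<close>.\<close>
lemma orbit_sum_tracks:
  fixes \<Phi> :: "'a::metric_space \<Rightarrow> 'b::real_normed_vector"
  assumes "compact (UNIV :: 'a set)" and "continuous_on UNIV \<Phi>" and "\<theta> > 0" and "\<epsilon>\<^sub>1 > 0"
  obtains \<epsilon> where "0 < \<epsilon>" "\<epsilon> \<le> \<epsilon>\<^sub>1"
    "\<And>T n x y. tracks T n \<epsilon> x y \<Longrightarrow> norm (orbit_sum T \<Phi> n y - orbit_sum T \<Phi> n x) \<le> real n * \<theta>"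
proof -
  have "bounded (range \<Phi>)"
    by (rule compact_imp_bounded[OF compact_continuous_image[OF assms(2,1)]])
  then obtain M where M: "M > 0" "\<And>x. norm (\<Phi> x) \<le> M"
    unfolding bounded_pos by auto
  have "uniformly_continuous_on UNIV \<Phi>"
    by (rule compact_uniformly_continuous[OF assms(2,1)])
  then obtain d where d: "d > 0" "\<And>p q. dist p q < d \<Longrightarrow> dist (\<Phi> p) (\<Phi> q) < \<theta> / 2"
    unfolding uniformly_continuous_on_def using \<open>\<theta> > 0\<close> by (metis UNIV_I half_gt_zero)
  \<comment> \<open>The last term makes the exceptional times contribute at most \<open>2 * M * \<epsilon> * n \<le> n * \<theta> / 2\<close>.\<close>
  define \<epsilon> where "\<epsilon> = min \<epsilon>\<^sub>1 (min (d / 2) (\<theta> / (4 * M)))"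
  have \<epsilon>: "\<epsilon> > 0" "\<epsilon> \<le> \<epsilon>\<^sub>1" "\<epsilon> < d" "2 * M * \<epsilon> \<le> \<theta> / 2"
  proof -
    show "\<epsilon> > 0" using assms d M by (simp add: \<epsilon>_def)
    show "\<epsilon> \<le> \<epsilon>\<^sub>1" "\<epsilon> < d" using d by (auto simp: \<epsilon>_def min_def)
    have "\<epsilon> \<le> \<theta> / (4 * M)" by (simp add: \<epsilon>_def)
    then show "2 * M * \<epsilon> \<le> \<theta> / 2" using M by (simp add: field_simps)
  qed
  show ?thesis
  proof (rule that[OF \<epsilon>(1,2)])
    fix T :: "'a \<Rightarrow> 'a" and n x y
    assume tr: "tracks T n \<epsilon> x y"
    define S where "S = {i. i < n \<and> dist ((T ^^ i) x) ((T ^^ i) y) > \<epsilon>}"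
    have S: "S \<subseteq> {..<n}" "real (card S) \<le> \<epsilon> * real n"
      using tr by (auto simp: S_def tracks_def deviations_def)
    let ?D = "\<lambda>i. norm (\<Phi> ((T ^^ i) y) - \<Phi> ((T ^^ i) x))"
    have "norm (orbit_sum T \<Phi> n y - orbit_sum T \<Phi> n x) \<le> (\<Sum>i<n. ?D i)"
      unfolding orbit_sum_def sum_subtractf[symmetric] by (rule norm_sum)
    also have "\<dots> \<le> (\<Sum>i<n. \<theta> / 2 + (if i \<in> S then 2 * M else 0))"
    proof (rule sum_mono)
      fix i assume i: "i \<in> {..<n}"
      show "?D i \<le> \<theta> / 2 + (if i \<in> S then 2 * M else 0)"
      proof (cases "i \<in> S")
        case True
        have "?D i \<le> norm (\<Phi> ((T ^^ i) y)) + norm (\<Phi> ((T ^^ i) x))" by (rule norm_triangle_ineq4)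
        also have "\<dots> \<le> M + M" using M(2) by (intro add_mono)
        finally show ?thesis using True \<open>\<theta> > 0\<close> by simp
      next
        case False
        then have "dist ((T ^^ i) y) ((T ^^ i) x) < d"
          using i \<epsilon>(3) by (auto simp: S_def dist_commute)
        then show ?thesis using d(2) False by (force simp: dist_norm)
      qed
    qed
    also have "\<dots> = real n * (\<theta> / 2) + real (card S) * (2 * M)"
      using S(1) Int_absorb1[OF S(1)] by (simp add: sum.distrib sum.If_cases)
    also have "\<dots> \<le> real n * (\<theta> / 2) + \<epsilon> * real n * (2 * M)"
      using S(2) M by (intro add_left_mono mult_right_mono) auto
    also have "\<dots> \<le> real n * (\<theta> / 2) + real n * (\<theta> / 2)"
      using mult_left_mono[OF \<epsilon>(4), of "real n"] by (simp add: algebra_simps)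
    finally show "norm (orbit_sum T \<Phi> n y - orbit_sum T \<Phi> n x) \<le> real n * \<theta>"
      by (simp add: mult.commute)
  qed
qed

text \<open>Two tracings destroy the separation at no more than \<open>2 * \<epsilon> * n\<close> times, fewer than the number of
times at which the traced points are far apart. This is why separation at a positive proportion of times is needed.\<close>
lemma tracks_separated:
  assumes dev: "real (deviations T n \<delta> x x') > \<beta> * real n"
    and tr: "tracks T n \<epsilon> x y" "tracks T n \<epsilon> x' y'"
    and \<epsilon>: "\<epsilon> \<le> \<delta> / 4" "\<epsilon> \<le> \<beta> / 2"
  shows "\<exists>i<n. dist ((T ^^ i) y) ((T ^^ i) y') > \<delta> / 2"
proof (rule ccontr)
  assume *: "\<not> ?thesis"
  let ?B = "\<lambda>\<epsilon> x y. {i. i < n \<and> dist ((T ^^ i) x) ((T ^^ i) y) > \<epsilon>}"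
  have "?B \<delta> x x' \<subseteq> ?B \<epsilon> x y \<union> ?B \<epsilon> x' y'"
  proof (rule subsetI, rule ccontr)
    fix i assume i: "i \<in> ?B \<delta> x x'" "i \<notin> ?B \<epsilon> x y \<union> ?B \<epsilon> x' y'"
    have "dist ((T ^^ i) x) ((T ^^ i) x')
        \<le> dist ((T ^^ i) x) ((T ^^ i) y) + dist ((T ^^ i) y) ((T ^^ i) y') + dist ((T ^^ i) x') ((T ^^ i) y')"
      using dist_triangle[of "(T ^^ i) x" "(T ^^ i) x'" "(T ^^ i) y"]
        dist_triangle[of "(T ^^ i) y" "(T ^^ i) x'" "(T ^^ i) y'"]
        dist_commute[of "(T ^^ i) y'" "(T ^^ i) x'"] by linarith
    moreover have "dist ((T ^^ i) y) ((T ^^ i) y') \<le> \<delta> / 2" using * i by force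
    ultimately show False using i \<epsilon>(1) by auto
  qed
  then have "card (?B \<delta> x x') \<le> card (?B \<epsilon> x y \<union> ?B \<epsilon> x' y')"
    by (intro card_mono) auto
  also have "\<dots> \<le> card (?B \<epsilon> x y) + card (?B \<epsilon> x' y')" by (rule card_Un_le)
  finally have "real (deviations T n \<delta> x x') \<le> \<epsilon> * real n + \<epsilon> * real n"
    using tr unfolding tracks_def deviations_def by linarith
  also have "\<dots> \<le> \<beta> * real n" using mult_right_mono[OF \<epsilon>(2), of "real n"] by simp
  finally show False using dev by simp
qed

lemma continuous_on_funpow:
  assumes "continuous_on UNIV (T :: 'a::topological_space \<Rightarrow> 'a)"
  shows "continuous_on UNIV (T ^^ i)"
proof (induction i)
  case 0 then show ?case by (simp add: id_def)
next
  case (Suc i)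
  then show ?case
    using continuous_on_compose[of UNIV "T ^^ i" T] continuous_on_subset[OF assms] by (simp add: o_def)
qed

text \<open>The condition is a finite union, over the possible sets of good times, of closed conditions.\<close>
lemma closed_tracks:
  assumes T: "continuous_on UNIV (T :: 'a::metric_space \<Rightarrow> 'a)"
  shows "closed {z. tracks T n \<epsilon> x ((T ^^ l) z)}"
proof -
  let ?C = "\<lambda>\<Lambda>. \<Inter>i\<in>\<Lambda>. {z. dist ((T ^^ i) x) ((T ^^ (l + i)) z) \<le> \<epsilon>}"
  let ?A = "{\<Lambda>. \<Lambda> \<subseteq> {..<n} \<and> real (card ({..<n} - \<Lambda>)) \<le> \<epsilon> * real n}"
  have "{z. tracks T n \<epsilon> x ((T ^^ l) z)} = (\<Union>\<Lambda>\<in>?A. ?C \<Lambda>)"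
  proof (intro equalityI subsetI)
    fix z assume "z \<in> {z. tracks T n \<epsilon> x ((T ^^ l) z)}"
    then have z: "tracks T n \<epsilon> x ((T ^^ l) z)" by simp
    define \<Lambda> where "\<Lambda> = {i. i < n \<and> dist ((T ^^ i) x) ((T ^^ (l + i)) z) \<le> \<epsilon>}"
    have "{..<n} - \<Lambda> = {i. i < n \<and> dist ((T ^^ i) x) ((T ^^ (l + i)) z) > \<epsilon>}"
      by (auto simp: \<Lambda>_def)
    then have "\<Lambda> \<in> ?A" using z by (auto simp: \<Lambda>_def tracks_def deviations_def funpow_shift)
    moreover have "z \<in> ?C \<Lambda>" by (auto simp: \<Lambda>_def)
    ultimately show "z \<in> (\<Union>\<Lambda>\<in>?A. ?C \<Lambda>)" by blast
  next
    fix z assume "z \<in> (\<Union>\<Lambda>\<in>?A. ?C \<Lambda>)"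
    then obtain \<Lambda> where \<Lambda>: "\<Lambda> \<in> ?A" "z \<in> ?C \<Lambda>" by blast
    have "{i. i < n \<and> dist ((T ^^ i) x) ((T ^^ i) ((T ^^ l) z)) > \<epsilon>} \<subseteq> {..<n} - \<Lambda>"
      using \<Lambda> by (force simp: funpow_shift)
    then have "deviations T n \<epsilon> x ((T ^^ l) z) \<le> card ({..<n} - \<Lambda>)"
      unfolding deviations_def by (intro card_mono) auto
    then show "z \<in> {z. tracks T n \<epsilon> x ((T ^^ l) z)}"
      using \<Lambda>(1) unfolding tracks_def by auto
  qed
  moreover have "closed (\<Union>\<Lambda>\<in>?A. ?C \<Lambda>)"
  proof (intro closed_UN closed_INT ballI)
    show "finite ?A" by simp
    fix i
    have "continuous_on UNIV (\<lambda>z. dist ((T ^^ i) x) ((T ^^ (l + i)) z))"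
      using continuous_on_funpow[OF T] by (intro continuous_intros)
    then show "closed {z. dist ((T ^^ i) x) ((T ^^ (l + i)) z) \<le> \<epsilon>}"
      by (intro closed_Collect_le continuous_on_const)
  qed
  ultimately show ?thesis by simp
qed

section \<open>Almost specification for infinitely many segments\<close>

text \<open>One threshold function for the block lengths, depending only on the precision, allows every infinite
sequence of long enough orbit segments to be traced by one point.\<close>
definition tracing_lengths :: "('a::metric_space \<Rightarrow> 'a) \<Rightarrow> (real \<Rightarrow> nat) \<Rightarrow> bool" where
  "tracing_lengths T N\<^sub>0 \<longleftrightarrow>
     (\<forall>(\<epsilon> :: nat \<Rightarrow> real) (n :: nat \<Rightarrow> nat) x. (\<forall>j. \<epsilon> j > 0 \<and> n j \<ge> N\<^sub>0 (\<epsilon> j)) \<longrightarrow>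
       (\<exists>z. \<forall>j. tracks T (n j) (\<epsilon> j) (x j) ((T ^^ (\<Sum>i<j. n i)) z)))"

lemma tracing_lengthsD:
  fixes \<epsilon> :: "nat \<Rightarrow> real" and n :: "nat \<Rightarrow> nat"
  assumes "tracing_lengths T N\<^sub>0" "\<And>j. \<epsilon> j > 0" "\<And>j. n j \<ge> N\<^sub>0 (\<epsilon> j)"
  shows "\<exists>z. \<forall>j. tracks T (n j) (\<epsilon> j) (x j) ((T ^^ (\<Sum>i<j. n i)) z)"
  using assms(1)[unfolded tracing_lengths_def, rule_format, of \<epsilon> n x] assms(2,3) by blast

text \<open>Since \<open>g n \<epsilon> / n\<close> tends to zero, long segments have at most \<open>\<epsilon> * n\<close> mistakes. The passage from finitely
many to infinitely many segments is by the finite intersection property of the closed tracing conditions.\<close>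
lemma almost_specification_tracks:
  fixes T :: "'a::metric_space \<Rightarrow> 'a"
  assumes cpt: "compact (UNIV :: 'a set)" and cont: "continuous_on UNIV T"
    and asp: "almost_specification T"
  obtains N\<^sub>0 where "tracing_lengths T N\<^sub>0"
proof -
  obtain \<epsilon>\<^sub>0 g where g: "mistake_function \<epsilon>\<^sub>0 g" and "almost_specification_with T g"
    using asp unfolding almost_specification_def by blast
  then obtain K where
    K2: "\<forall>m\<ge>1. \<forall>(\<epsilon> :: nat \<Rightarrow> real) (x :: nat \<Rightarrow> 'a) (n :: nat \<Rightarrow> nat).
           (\<forall>j\<in>{1..m}. \<epsilon> j > 0 \<and> n j \<ge> K (\<epsilon> j)) \<longrightarrow>
           (\<exists>z. \<forall>j\<in>{1..m}. (T ^^ (\<Sum>s=1..<j. n s)) z \<in> mistake_ball T g (n j) (x j) (\<epsilon> j))"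
    unfolding almost_specification_with_def by (elim exE conjE) (rule that)
  have sp: "\<exists>z. \<forall>j\<in>{1..m}. (T ^^ (\<Sum>s=1..<j. n s)) z \<in> mistake_ball T g (n j) (x j) (\<epsilon> j)"
    if "m \<ge> 1" "\<forall>j\<in>{1..m}. \<epsilon> j > 0 \<and> n j \<ge> K (\<epsilon> j)" for m \<epsilon> x and n :: "nat \<Rightarrow> nat"
    using K2[THEN spec, of m, THEN mp, OF that(1), THEN spec, of \<epsilon>, THEN spec, of x, THEN spec, of n, THEN mp, OF that(2)] .
  have lim: "(\<lambda>n. real (g n \<epsilon>) / real n) \<longlonglongrightarrow> 0" if "\<epsilon> > 0" for \<epsilon>
  proof -
    note g' = g[unfolded mistake_function_def]
    have lim0: "(\<lambda>n. real (g n \<epsilon>') / real n) \<longlonglongrightarrow> 0" if "\<epsilon>' \<in> {0<..\<epsilon>\<^sub>0}" for \<epsilon>'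
      by (rule g'[THEN conjunct2, THEN conjunct1, THEN bspec, OF that, THEN conjunct2])
    show ?thesis
    proof (cases "\<epsilon> \<le> \<epsilon>\<^sub>0")
      case True
      then show ?thesis using lim0[of \<epsilon>] that by simp
    next
      case False
      then have "(\<lambda>n. g n \<epsilon>) = (\<lambda>n. g n \<epsilon>\<^sub>0)"
        by (intro ext g'[THEN conjunct2, THEN conjunct2, rule_format]) simp
      moreover have "(\<lambda>n. real (g n \<epsilon>\<^sub>0) / real n) \<longlonglongrightarrow> 0"
        using lim0[of \<epsilon>\<^sub>0] g'[THEN conjunct1] by simp
      ultimately show ?thesis by metis
    qed
  qed
  have ex: "\<exists>N. \<forall>n\<ge>N. n \<ge> K \<epsilon> \<and> real (g n \<epsilon>) \<le> \<epsilon> * real n" if "\<epsilon> > 0" for \<epsilon>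
  proof -
    from order_tendstoD(2)[OF lim[OF that] that] obtain N where
      N: "\<And>n. n \<ge> N \<Longrightarrow> real (g n \<epsilon>) / real n < \<epsilon>" by (auto simp: eventually_sequentially)
    have "real (g n \<epsilon>) \<le> \<epsilon> * real n" if "n \<ge> max (max N 1) (K \<epsilon>)" for n
      using N[of n] that by (simp add: field_simps)
    then show ?thesis by (intro exI[of _ "max (max N 1) (K \<epsilon>)"]) auto
  qed
  define N\<^sub>0 where "N\<^sub>0 \<epsilon> = (SOME N. \<forall>n\<ge>N. n \<ge> K \<epsilon> \<and> real (g n \<epsilon>) \<le> \<epsilon> * real n)" for \<epsilon>
  have N\<^sub>0: "n \<ge> K \<epsilon> \<and> real (g n \<epsilon>) \<le> \<epsilon> * real n" if "\<epsilon> > 0" "n \<ge> N\<^sub>0 \<epsilon>" for n \<epsilon>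
    using someI_ex[OF ex[OF that(1)]] that(2) unfolding N\<^sub>0_def by blast
  show ?thesis
  proof (rule that, unfold tracing_lengths_def, intro allI impI)
    fix \<epsilon> :: "nat \<Rightarrow> real" and n :: "nat \<Rightarrow> nat" and x :: "nat \<Rightarrow> 'a"
    assume "\<forall>j. \<epsilon> j > 0 \<and> n j \<ge> N\<^sub>0 (\<epsilon> j)"
    then have *: "\<And>j. \<epsilon> j > 0 \<and> n j \<ge> N\<^sub>0 (\<epsilon> j)" by blast
    define C where "C j = {z. tracks T (n j) (\<epsilon> j) (x j) ((T ^^ (\<Sum>i<j. n i)) z)}" for j
    have fin: "(\<Inter>j<m. C j) \<noteq> {}" for m
    proof (cases "m = 0")
      case True then show ?thesis by simp
    next
      case False
      then have m: "m \<ge> 1" by simp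
      have "\<exists>z. \<forall>j\<in>{1..m}. (T ^^ (\<Sum>s=1..<j. n (s - 1))) z
          \<in> mistake_ball T g (n (j - 1)) (x (j - 1)) (\<epsilon> (j - 1))"
        using * N\<^sub>0 by (intro sp[OF m, where x = "\<lambda>j. x (j - 1)"]) blast
      then obtain z where z: "\<And>j. j \<in> {1..m} \<Longrightarrow> (T ^^ (\<Sum>s=1..<j. n (s - 1))) z
          \<in> mistake_ball T g (n (j - 1)) (x (j - 1)) (\<epsilon> (j - 1))" by blast
      have "z \<in> C j" if "j < m" for j
      proof -
        have "(\<Sum>s=1..<Suc j. n (s - 1)) = (\<Sum>i<j. n i)"
          using sum.shift_bounds_Suc_ivl[of "\<lambda>s. n (s - 1)" 0 j] by (simp add: atLeast0LessThan)
        then have "(T ^^ (\<Sum>i<j. n i)) z \<in> mistake_ball T g (n j) (x j) (\<epsilon> j)"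
          using z[of "Suc j"] that by simp
        then obtain \<Lambda> where \<Lambda>: "\<Lambda> \<subseteq> {..<n j}" "card \<Lambda> \<ge> n j - g (n j) (\<epsilon> j)"
          "\<forall>i\<in>\<Lambda>. dist ((T ^^ i) (x j)) ((T ^^ i) ((T ^^ (\<Sum>i<j. n i)) z)) < \<epsilon> j"
          unfolding mistake_ball_def by blast
        have "{i. i < n j \<and> dist ((T ^^ i) (x j)) ((T ^^ i) ((T ^^ (\<Sum>i<j. n i)) z)) > \<epsilon> j} \<subseteq> {..<n j} - \<Lambda>"
          using \<Lambda> by force
        then have "deviations T (n j) (\<epsilon> j) (x j) ((T ^^ (\<Sum>i<j. n i)) z) \<le> card ({..<n j} - \<Lambda>)"
          unfolding deviations_def by (intro card_mono) auto
        also have "\<dots> = n j - card \<Lambda>"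
          using \<Lambda>(1) by (subst card_Diff_subset) (auto intro: finite_subset)
        also have "\<dots> \<le> g (n j) (\<epsilon> j)" using \<Lambda>(2) by simp
        finally show ?thesis using N\<^sub>0[of "\<epsilon> j" "n j"] *[of j] unfolding C_def tracks_def by simp
      qed
      then show ?thesis by auto
    qed
    have "UNIV \<inter> \<Inter>(range C) \<noteq> {}"
    proof (rule compact_imp_fip[OF cpt])
      show "closed S" if "S \<in> range C" for S using that closed_tracks[OF cont] by (auto simp: C_def)
      fix F assume "finite F" "F \<subseteq> range C"
      then obtain J where J: "finite J" "F = C ` J" by (metis finite_subset_image)
      obtain m where "J \<subseteq> {..<m}"
        using J(1) by (metis finite_nat_bounded)
      then show "UNIV \<inter> \<Inter>F \<noteq> {}" using fin[of m] J by auto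
    qed
    then show "\<exists>z. \<forall>j. tracks T (n j) (\<epsilon> j) (x j) ((T ^^ (\<Sum>i<j. n i)) z)" unfolding C_def by auto
  qed
qed

section \<open>Monotonicity of the entropy\<close>

text \<open>More balls are admissible if they are larger and may be shorter, and a smaller set is easier to cover.\<close>
lemma bowen_C_at_mono:
  assumes "Z \<subseteq> Z'" "\<epsilon>' \<le> \<epsilon>" "N \<le> N'"
  shows "bowen_C_at T Z s \<epsilon> N \<le> bowen_C_at T Z' s \<epsilon>' N'"
  unfolding bowen_C_at_def
proof (rule Inf_superset_mono, safe)
  fix I x n assume c: "bowen_cover T Z' \<epsilon>' N' I x n"
  have "bowen_ball T m y \<epsilon>' \<subseteq> bowen_ball T m y \<epsilon>" for m y
    using assms(2) by (force simp: bowen_ball_def)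
  then have "bowen_cover T Z \<epsilon> N I x n"
    using c assms unfolding bowen_cover_def by (meson UN_mono order_trans subset_refl)
  then show "\<exists>Ia xa na. (\<Sum>\<^sub>\<infinity>i\<in>I. ennreal (exp (- s * real (n i)))) =
      (\<Sum>\<^sub>\<infinity>i\<in>Ia. ennreal (exp (- s * real (na i)))) \<and> bowen_cover T Z \<epsilon> N Ia xa na" by blast
qed

lemma bowen_C_eq_SUP: "bowen_C T Z s \<epsilon> = (SUP N. bowen_C_at T Z s \<epsilon> N)"
  unfolding bowen_C_def
  by (intro limI LIMSEQ_SUP monoI bowen_C_at_mono) auto

lemma bowen_C_mono:
  assumes "Z \<subseteq> Z'" "\<epsilon>' \<le> \<epsilon>"
  shows "bowen_C T Z s \<epsilon> \<le> bowen_C T Z' s \<epsilon>'"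
  unfolding bowen_C_eq_SUP by (intro SUP_mono') (use assms bowen_C_at_mono in blast)

lemma entropy_at_mono:
  assumes "Z \<subseteq> Z'" "\<epsilon>' \<le> \<epsilon>"
  shows "entropy_at T Z \<epsilon> \<le> entropy_at T Z' \<epsilon>'"
  unfolding entropy_at_def
proof (intro Inf_superset_mono image_mono subsetI)
  fix s assume "s \<in> {s. bowen_C T Z' s \<epsilon>' = 0}"
  then show "s \<in> {s. bowen_C T Z s \<epsilon> = 0}" using bowen_C_mono[OF assms, of T s] by simp
qed

lemma top_entropy_eq_SUP: "top_entropy T Z = (SUP \<epsilon>\<in>{0<..}. entropy_at T Z \<epsilon>)"
proof -
  have "(entropy_at T Z \<longlongrightarrow> (SUP \<epsilon>\<in>{0<..}. entropy_at T Z \<epsilon>)) (at_right 0)"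
  proof (rule increasing_tendsto)
    show "\<forall>\<^sub>F \<epsilon> in at_right 0. entropy_at T Z \<epsilon> \<le> (SUP \<epsilon>\<in>{0<..}. entropy_at T Z \<epsilon>)"
      by (auto simp: eventually_at_right_field intro!: exI[of _ 1] SUP_upper)
    fix a assume "a < (SUP \<epsilon>\<in>{0<..}. entropy_at T Z \<epsilon>)"
    then obtain \<epsilon>' where \<epsilon>': "\<epsilon>' > 0" "a < entropy_at T Z \<epsilon>'" by (auto simp: less_SUP_iff)
    have "a < entropy_at T Z \<epsilon>" if "\<epsilon> < \<epsilon>'" for \<epsilon>
      using entropy_at_mono[of Z Z \<epsilon> \<epsilon>' T] that \<epsilon>'(2) by (meson less_imp_le order_refl order_less_le_trans)
    then show "\<forall>\<^sub>F \<epsilon> in at_right 0. a < entropy_at T Z \<epsilon>"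
      using \<epsilon>'(1) by (auto simp: eventually_at_right_field)
  qed
  then show ?thesis unfolding top_entropy_def by (rule tendsto_Lim[rotated]) simp
qed

lemma top_entropy_mono: "Z \<subseteq> Z' \<Longrightarrow> top_entropy T Z \<le> top_entropy T Z'"
  unfolding top_entropy_eq_SUP by (intro SUP_mono') (auto intro: entropy_at_mono)

lemma ennreal_sum_le_infsum:
  fixes f :: "'i \<Rightarrow> ennreal"
  assumes "finite F" "F \<subseteq> I"
  shows "sum f F \<le> infsum f I"
proof -
  have "infsum f F \<le> infsum f I"
    by (rule infsum_mono_neutral) (use assms in \<open>auto intro: nonneg_summable_on_complete\<close>)
  then show ?thesis using assms by simp
qed

text \<open>Every ball of a cover contributes at least one when \<open>s\<close> is nonpositive; so the entropy of a nonempty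
set is nonnegative.\<close>
lemma bowen_C_nonzero_nonpos:
  assumes "Z \<noteq> {}" "s \<le> 0"
  shows "bowen_C T Z s \<epsilon> \<noteq> 0"
proof -
  have "1 \<le> bowen_C_at T Z s \<epsilon> 0"
    unfolding bowen_C_at_def
  proof (rule Inf_greatest, safe)
    fix I x n assume "bowen_cover T Z \<epsilon> 0 I x n"
    then obtain i where i: "i \<in> I" using assms(1) unfolding bowen_cover_def by blast
    have "0 \<le> - s * real (n i)" using assms(2) by (simp add: mult_nonpos_nonneg)
    then have "1 \<le> ennreal (exp (- s * real (n i)))"
      by (simp add: ennreal_le_iff flip: ennreal_1)
    also have "\<dots> \<le> (\<Sum>\<^sub>\<infinity>i\<in>I. ennreal (exp (- s * real (n i))))"
      using ennreal_sum_le_infsum[of "{i}" I "\<lambda>i. ennreal (exp (- s * real (n i)))"] i by simp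
    finally show "1 \<le> (\<Sum>\<^sub>\<infinity>i\<in>I. ennreal (exp (- s * real (n i))))" .
  qed
  also have "\<dots> \<le> bowen_C T Z s \<epsilon>" unfolding bowen_C_eq_SUP by (rule SUP_upper) simp
  finally show ?thesis by auto
qed

section \<open>Separated sets from entropy\<close>

lemma maximal_spread_covers:
  assumes bound: "\<And>E. finite E \<Longrightarrow> spread T n \<delta> 0 E \<Longrightarrow> card E < B" and "\<delta> \<ge> 0"
  obtains E where "finite E" "spread T n \<delta> 0 E" "\<And>y. \<exists>x\<in>E. deviations T n \<delta> x y = 0"
proof -
  define P where "P m \<longleftrightarrow> (\<exists>E. finite E \<and> spread T n \<delta> 0 E \<and> card E = m)" for m
  have "P 0" unfolding P_def by (intro exI[of _ "{}"]) (simp add: spread_def)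
  moreover have "\<And>m. P m \<Longrightarrow> m \<le> B" unfolding P_def using bound less_imp_le by blast
  ultimately obtain m where m: "P m" "\<And>m'. P m' \<Longrightarrow> m' \<le> m"
    by (metis Nat.ex_has_greatest_nat)
  then obtain E where E: "finite E" "spread T n \<delta> 0 E" "card E = m" by (auto simp: P_def)
  have "\<exists>x\<in>E. deviations T n \<delta> x y = 0" for y
  proof (rule ccontr)
    assume no: "\<not> ?thesis"
    then have "y \<notin> E" using deviations_self[OF \<open>\<delta> \<ge> 0\<close>] by blast
    moreover have "spread T n \<delta> 0 (insert y E)"
      unfolding spread_def
    proof (intro ballI impI)
      fix a b assume ab: "a \<in> insert y E" "b \<in> insert y E" "a \<noteq> b"
      show "0 < real (deviations T n \<delta> a b)"
      proof (cases "a \<in> E \<and> b \<in> E")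
        case True
        then show ?thesis using E(2) ab(3) by (simp add: spread_def)
      next
        case False
        then have "a \<in> E \<and> b = y \<or> a = y \<and> b \<in> E" using ab by blast
        then have "deviations T n \<delta> a b \<noteq> 0" using no deviations_commute[of T n \<delta> y b] by metis
        then show ?thesis by simp
      qed
    qed
    ultimately have "P (Suc m)" using E(1,3) unfolding P_def by (intro exI[of _ "insert y E"]) simp
    from m(2)[OF this] show False by simp
  qed
  then show ?thesis using E that by blast
qed

text \<open>A maximal separated set is the set of centres of a cover by Bowen balls of one and the same length. If
separated sets were small for all large \<open>n\<close>, these covers would give entropy at most \<open>h\<close>.\<close>
lemma entropy_imp_spread:
  assumes "ereal h < top_entropy T UNIV"
  obtains \<delta> where "\<delta> > 0"
    "\<forall>N. \<exists>n\<ge>N. \<exists>E. finite E \<and> exp (h * real n) \<le> real (card E) \<and> spread T n \<delta> 0 E"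
proof -
  from assms obtain \<epsilon> where \<epsilon>: "\<epsilon> > 0" "ereal h < entropy_at T UNIV \<epsilon>"
    unfolding top_entropy_eq_SUP by (auto simp: less_SUP_iff)
  \<comment> \<open>The room between \<open>h\<close> and \<open>s\<close> makes the covering sums at exponent \<open>s\<close> tend to zero.\<close>
  obtain s where s: "ereal h < ereal s" "ereal s < entropy_at T UNIV \<epsilon>"
    using ereal_dense2[OF \<epsilon>(2)] by auto
  have "\<exists>n\<ge>N. \<exists>E. finite E \<and> exp (h * real n) \<le> real (card E) \<and> spread T n (\<epsilon> / 2) 0 E" for N
  proof (rule ccontr)
    assume "\<not> ?thesis"
    then have small: "\<And>n E. n \<ge> N \<Longrightarrow> finite E \<Longrightarrow> spread T n (\<epsilon> / 2) 0 E \<Longrightarrow> real (card E) < exp (h * real n)"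
      by force
    have C: "bowen_C_at T UNIV s \<epsilon> M \<le> ennreal (exp ((h - s) * real n))" if "n \<ge> N" "n \<ge> M" for n M
    proof -
      have "card E < nat \<lceil>exp (h * real n)\<rceil>" if "finite E" "spread T n (\<epsilon> / 2) 0 E" for E
        using small[OF \<open>n \<ge> N\<close> that] by linarith
      then obtain E where E: "finite E" "spread T n (\<epsilon> / 2) 0 E" "\<And>y. \<exists>x\<in>E. deviations T n (\<epsilon> / 2) x y = 0"
        using maximal_spread_covers[of T n "\<epsilon> / 2"] \<epsilon>(1) by (metis half_gt_zero less_imp_le)
      obtain f where f: "bij_betw f {..<card E} E"
        using ex_bij_betw_nat_finite[OF E(1)] by (auto simp: atLeast0LessThan)
      have "bowen_cover T UNIV \<epsilon> M {..<card E} f (\<lambda>_. n)"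
        unfolding bowen_cover_def
      proof (intro conjI ballI subsetI)
        show "M \<le> n" by (rule that)
        fix y
        obtain x where x: "x \<in> E" "deviations T n (\<epsilon> / 2) x y = 0" using E(3) by blast
        then obtain i where "i < card E" "f i = x" using f by (metis bij_betw_imp_surj_on imageE lessThan_iff)
        moreover have "y \<in> bowen_ball T n x \<epsilon>"
          using x(2) \<epsilon>(1) by (force simp: bowen_ball_def deviations_eq_0)
        ultimately show "y \<in> (\<Union>i<card E. bowen_ball T n (f i) \<epsilon>)" by blast
      qed
      then have "bowen_C_at T UNIV s \<epsilon> M \<le> (\<Sum>\<^sub>\<infinity>i\<in>{..<card E}. ennreal (exp (- s * real n)))"
        unfolding bowen_C_at_def
        by (intro Inf_lower CollectI exI[of _ "{..<card E}"] exI[of _ f] exI[of _ "\<lambda>_. n"] conjI refl)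
      also have "\<dots> = ennreal (real (card E) * exp (- s * real n))"
        by (simp add: ennreal_mult ennreal_of_nat_eq_real_of_nat)
      also have "\<dots> \<le> ennreal (exp (h * real n) * exp (- s * real n))"
        using small[OF \<open>n \<ge> N\<close> E(1,2)] by (intro ennreal_leI mult_right_mono) auto
      also have "exp (h * real n) * exp (- s * real n) = exp ((h - s) * real n)"
        by (simp add: exp_add[symmetric] algebra_simps)
      finally show ?thesis .
    qed
    have "bowen_C_at T UNIV s \<epsilon> M = 0" for M
    proof -
      have "(\<lambda>n. exp (h - s) ^ n) \<longlonglongrightarrow> 0" using s(1) by (intro LIMSEQ_realpow_zero) auto
      then have "(\<lambda>n. ennreal (exp ((h - s) * real n))) \<longlonglongrightarrow> ennreal 0"
        by (intro tendsto_ennrealI) (simp add: exp_of_nat2_mult)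
      then have "bowen_C_at T UNIV s \<epsilon> M \<le> ennreal 0"
        by (rule tendsto_lowerbound)
          (use C in \<open>auto simp: eventually_sequentially intro!: exI[of _ "max N M"]\<close>)
      then show ?thesis by simp
    qed
    then have "bowen_C T UNIV s \<epsilon> = 0" unfolding bowen_C_eq_SUP by simp
    then have "entropy_at T UNIV \<epsilon> \<le> ereal s" unfolding entropy_at_def by (intro Inf_lower) blast
    then show False using s(2) by simp
  qed
  then show ?thesis using that[of "\<epsilon> / 2"] \<epsilon>(1) by simp
qed

section \<open>Separation at a positive proportion of times\<close>

text \<open>The number of functions with few values other than \<open>None\<close> is estimated by a generating function: when
each such value has weight \<open>t\<close>, all functions together have weight \<open>(1 + card K * t) ^ n\<close>, and each of
the functions in question has weight at least \<open>t powr k\<close>.\<close>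
lemma sparse_patterns_card:
  fixes K :: "'c set" and t k :: real and n :: nat
  assumes "finite K" "0 < t" "t \<le> 1"
  defines "F \<equiv> {p \<in> {..<n} \<rightarrow>\<^sub>E insert None (Some ` K). real (card {i. i < n \<and> p i \<noteq> None}) \<le> k}"
  shows "finite F" "real (card F) * t powr k \<le> (1 + real (card K) * t) ^ n"
proof -
  let ?D = "insert None (Some ` K)"
  define w where "w = (\<lambda>a :: 'c option. if a = None then 1 else t)"
  have fin: "finite ({..<n} \<rightarrow>\<^sub>E ?D)" using assms(1) by (intro finite_PiE) auto
  then show "finite F" unfolding F_def by simp
  have prod_w: "(\<Prod>i<n. w (p i)) = t ^ card {i. i < n \<and> p i \<noteq> None}" for p
  proof -
    have "(\<Prod>i<n. w (p i)) = (\<Prod>i\<in>{i \<in> {..<n}. p i \<noteq> None}. t)"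
      unfolding w_def by (subst prod.inter_filter) (auto intro!: prod.cong)
    then show ?thesis by simp
  qed
  have "real (card F) * t powr k = (\<Sum>p\<in>F. t powr k)" by simp
  also have "\<dots> \<le> (\<Sum>p\<in>F. \<Prod>i<n. w (p i))"
  proof (rule sum_mono)
    fix p assume "p \<in> F"
    then have "real (card {i. i < n \<and> p i \<noteq> None}) \<le> k" by (simp add: F_def)
    then have "t powr k \<le> t powr real (card {i. i < n \<and> p i \<noteq> None})"
      using assms by (intro powr_mono') auto
    then show "t powr k \<le> (\<Prod>i<n. w (p i))" using assms(2) by (simp add: prod_w powr_realpow)
  qed
  also have "\<dots> \<le> (\<Sum>p\<in>{..<n} \<rightarrow>\<^sub>E ?D. \<Prod>i<n. w (p i))"
    using fin assms(2) by (intro sum_mono2 prod_nonneg) (auto simp: F_def w_def)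
  also have "\<dots> = (\<Prod>i<n. \<Sum>a\<in>?D. w a)"
    using assms(1) by (subst prod_sum_PiE) auto
  also have "(\<Sum>a\<in>?D. w a) = 1 + real (card K) * t"
    using assms(1) by (subst sum.insert) (auto simp: w_def sum.reindex)
  finally show "real (card F) * t powr k \<le> (1 + real (card K) * t) ^ n" by simp
qed

text \<open>A point \<open>y\<close> of a separated set that is close to \<open>x\<close> at most times is determined by the set of
the other times together with the cell of a finite partition in which the orbit of \<open>y\<close> lies at each of them.
Such data are sparse patterns.\<close>
lemma card_close_orbits:
  fixes T :: "'a::metric_space \<Rightarrow> 'a" and K :: "'a set"
  assumes "finite E" "spread T n \<delta> 0 E" "0 < \<delta>" "0 < t" "t \<le> 1"
    and K: "finite K" "\<And>y. \<exists>p\<in>K. dist p y < \<delta> / 2"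
  shows "real (card {y\<in>E. real (deviations T n (\<delta> / 2) x y) \<le> k}) * t powr k \<le> (1 + real (card K) * t) ^ n"
proof -
  define F where "F = {p \<in> {..<n} \<rightarrow>\<^sub>E insert None (Some ` K). real (card {i. i < n \<and> p i \<noteq> None}) \<le> k}"
  obtain q where q: "\<And>y. q y \<in> K" "\<And>y. dist (q y) y < \<delta> / 2" using K(2) by metis
  define far where "far y i \<longleftrightarrow> dist ((T ^^ i) x) ((T ^^ i) y) > \<delta> / 2" for y i
  define c where "c y = (\<lambda>i\<in>{..<n}. if far y i then Some (q ((T ^^ i) y)) else None)" for y
  let ?A = "{y\<in>E. real (deviations T n (\<delta> / 2) x y) \<le> k}"
  have "inj_on c ?A"
  proof (rule inj_onI, rule ccontr)
    fix y y' assume y: "y \<in> ?A" "y' \<in> ?A" and eq: "c y = c y'" and "y \<noteq> y'"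
    have "dist ((T ^^ i) y) ((T ^^ i) y') \<le> \<delta>" if "i < n" for i
    proof -
      have ci: "c y i = c y' i" using eq by simp
      show ?thesis
      proof (cases "far y i")
        case True
        then have "q ((T ^^ i) y) = q ((T ^^ i) y')" using ci that by (auto simp: c_def split: if_splits)
        then show ?thesis using q(2)[of "(T ^^ i) y"] q(2)[of "(T ^^ i) y'"]
          dist_triangle3[of "(T ^^ i) y" "(T ^^ i) y'" "q ((T ^^ i) y)"] by simp
      next
        case False
        then have "\<not> far y' i" using ci that by (auto simp: c_def split: if_splits)
        then show ?thesis using False dist_triangle3[of "(T ^^ i) y" "(T ^^ i) y'" "(T ^^ i) x"]
          by (simp add: far_def)
      qed
    qed
    then have "deviations T n \<delta> y y' = 0" by (simp add: deviations_eq_0)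
    then show False
      using assms(2)[unfolded spread_def, rule_format, of y y'] y \<open>y \<noteq> y'\<close> by simp
  qed
  moreover have "c ` ?A \<subseteq> F"
  proof (rule image_subsetI)
    fix y assume y: "y \<in> ?A"
    have "{i. i < n \<and> c y i \<noteq> None} = {i. i < n \<and> dist ((T ^^ i) x) ((T ^^ i) y) > \<delta> / 2}"
      by (auto simp: c_def far_def)
    moreover have "c y \<in> {..<n} \<rightarrow>\<^sub>E insert None (Some ` K)"
      using q(1) by (auto simp: c_def)
    ultimately show "c y \<in> F" using y by (simp add: F_def deviations_def)
  qed
  ultimately have "card ?A \<le> card F"
    using sparse_patterns_card(1)[OF K(1) assms(4,5), of n k] unfolding F_def
    by (intro card_inj_on_le) auto
  then have "real (card ?A) * t powr k \<le> real (card F) * t powr k" by (intro mult_right_mono) auto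
  also have "\<dots> \<le> (1 + real (card K) * t) ^ n"
    unfolding F_def by (rule sparse_patterns_card(2)[OF K(1) assms(4,5)])
  finally show ?thesis .
qed

text \<open>A maximal subset with the stronger separation: every point of \<open>E\<close> is close to one of its points.\<close>
lemma spread_subset_card:
  assumes "finite E" "\<delta> \<ge> 0" "k \<ge> 0" "B \<ge> 0"
    and close: "\<And>x. x \<in> E \<Longrightarrow> real (card {y\<in>E. real (deviations T n \<delta> x y) \<le> k}) \<le> B"
  obtains E' where "E' \<subseteq> E" "spread T n \<delta> k E'" "real (card E) \<le> real (card E') * B"
proof -
  define P where "P E' \<longleftrightarrow> E' \<subseteq> E \<and> spread T n \<delta> k E'" for E'
  have "P {}" by (simp add: P_def spread_def)
  moreover have "card E' < Suc (card E)" if "P E'" for E'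
    using that assms(1) by (simp add: P_def card_mono less_Suc_eq_le)
  ultimately obtain E' where E': "P E'" "\<forall>E''. P E'' \<longrightarrow> card E'' \<le> card E'"
    using ex_has_greatest_nat[of P "{}" card "Suc (card E)"] by metis
  have fin: "finite E'" using E'(1) assms(1) by (auto simp: P_def intro: finite_subset)
  have "E \<subseteq> (\<Union>x\<in>E'. {y\<in>E. real (deviations T n \<delta> x y) \<le> k})"
  proof (rule subsetI, rule ccontr)
    fix y assume y: "y \<in> E" and no: "y \<notin> (\<Union>x\<in>E'. {y\<in>E. real (deviations T n \<delta> x y) \<le> k})"
    then have far: "\<And>x. x \<in> E' \<Longrightarrow> k < real (deviations T n \<delta> x y)" by (auto simp: not_le)
    have "y \<notin> E'" using far[of y] deviations_self[OF assms(2), of T n y] assms(3) by auto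
    moreover have "P (insert y E')"
      unfolding P_def spread_def
    proof (intro conjI ballI impI)
      show "insert y E' \<subseteq> E" using y E'(1) by (auto simp: P_def)
      fix a b assume ab: "a \<in> insert y E'" "b \<in> insert y E'" "a \<noteq> b"
      show "k < real (deviations T n \<delta> a b)"
      proof (cases "a \<in> E' \<and> b \<in> E'")
        case True
        then show ?thesis using E'(1) ab(3) by (simp add: P_def spread_def)
      next
        case False
        then have "a \<in> E' \<and> b = y \<or> a = y \<and> b \<in> E'" using ab by blast
        then show ?thesis using far deviations_commute[of T n \<delta> y b] by auto
      qed
    qed
    ultimately show False using E'(2)[rule_format, of "insert y E'"] fin by simp
  qed
  then have "card E \<le> card (\<Union>x\<in>E'. {y\<in>E. real (deviations T n \<delta> x y) \<le> k})"
    using fin assms(1) by (intro card_mono) auto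
  also have "\<dots> \<le> (\<Sum>x\<in>E'. card {y\<in>E. real (deviations T n \<delta> x y) \<le> k})" using fin by (rule card_UN_le)
  finally have "real (card E) \<le> (\<Sum>x\<in>E'. real (card {y\<in>E. real (deviations T n \<delta> x y) \<le> k}))"
    by (simp flip: of_nat_sum)
  also have "\<dots> \<le> (\<Sum>x\<in>E'. B)" using E'(1) by (intro sum_mono close) (auto simp: P_def)
  finally have "real (card E) \<le> real (card E') * B" by simp
  then show ?thesis using that E'(1) unfolding P_def by blast
qed

text \<open>The proportion \<open>\<beta>\<close> depends on the loss \<open>h - h'\<close> but not on \<open>v\<close>, so that one \<open>\<beta>\<close> serves the two
vectors between which the averages oscillate.\<close>
lemma rich_thin:
  fixes T :: "'a::metric_space \<Rightarrow> 'a" and \<Phi> :: "'a \<Rightarrow> 'b::real_normed_vector"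
  assumes cpt: "compact (UNIV :: 'a set)" and "\<delta> > 0" "h' < h"
  obtains \<beta> where "\<beta> > 0" "\<forall>v. rich T \<Phi> \<delta> 0 h v \<longrightarrow> rich T \<Phi> (\<delta> / 2) \<beta> h' v"
proof -
  obtain K where K: "finite K" "UNIV \<subseteq> (\<Union>p\<in>K. ball p (\<delta> / 2) :: 'a set)"
    using compactE_image[OF cpt, of UNIV "\<lambda>p. ball p (\<delta> / 2)"] \<open>\<delta> > 0\<close>
    by (metis UNIV_I centre_in_ball half_gt_zero open_ball UN_I subsetI)
  have K2: "\<exists>p\<in>K. dist p y < \<delta> / 2" for y
  proof -
    have "y \<in> (\<Union>p\<in>K. ball p (\<delta> / 2))" using K(2) by blast
    then show ?thesis by auto
  qed
  define C where "C = real (card K) + 1"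
  define \<gamma> where "\<gamma> = (h - h') / 2"
  have \<gamma>: "\<gamma> > 0" using assms(3) by (simp add: \<gamma>_def)
  \<comment> \<open>First \<open>t\<close> makes the base \<open>1 + card K * t\<close> at most \<open>exp \<gamma>\<close>, then \<open>\<beta>\<close> makes \<open>t powr (\<beta> * n)\<close> equal to
    \<open>exp (- \<gamma> * n)\<close>; the number of orbits close to a given one is thus at most \<open>exp (2 * \<gamma> * n)\<close>.\<close>
  define t where "t = min (1 / 2) (\<gamma> / C)"
  have C: "C \<ge> 1" by (simp add: C_def)
  have t: "0 < t" "t < 1" "C * t \<le> \<gamma>"
  proof -
    show "0 < t" "t < 1" using \<gamma> C by (auto simp: t_def)
    have "t \<le> \<gamma> / C" by (simp add: t_def)
    then show "C * t \<le> \<gamma>" using C by (simp add: field_simps)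
  qed
  define \<beta> where "\<beta> = \<gamma> / (- ln t)"
  have lnt: "ln t < 0" using t by simp
  have \<beta>: "\<beta> > 0" using \<gamma> lnt by (simp add: \<beta>_def divide_pos_neg)
  have "rich T \<Phi> (\<delta> / 2) \<beta> h' v" if r: "rich T \<Phi> \<delta> 0 h v" for v
    unfolding rich_def
  proof (intro allI impI)
    fix \<eta> :: real and N :: nat assume "\<eta> > 0"
    with r obtain n E where nE: "n \<ge> N" "finite E" "exp (h * real n) \<le> real (card E)" "spread T n \<delta> 0 E"
      "\<forall>x\<in>E. norm (orbit_sum T \<Phi> n x - real n *\<^sub>R v) \<le> \<eta> * real n"
      unfolding rich_def by (metis mult_zero_left)
    define k where "k = \<beta> * real n"
    define B where "B = exp ((h - h') * real n)"
    have "real (card {y\<in>E. real (deviations T n (\<delta> / 2) x y) \<le> k}) \<le> B" for x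
    proof -
      have tk: "t powr k = exp (- \<gamma> * real n)"
        using t lnt by (simp add: powr_def k_def \<beta>_def)
      have "real (card {y\<in>E. real (deviations T n (\<delta> / 2) x y) \<le> k}) * t powr k
          \<le> (1 + real (card K) * t) ^ n"
        using card_close_orbits[OF nE(2,4) \<open>\<delta> > 0\<close> t(1) _ K(1) K2] t(2) by simp
      also have "\<dots> \<le> exp \<gamma> ^ n"
      proof (rule power_mono)
        have "1 + real (card K) * t \<le> 1 + C * t" using t by (simp add: C_def)
        also have "\<dots> \<le> exp (C * t)" by (rule exp_ge_add_one_self)
        also have "\<dots> \<le> exp \<gamma>" using t by simp
        finally show "1 + real (card K) * t \<le> exp \<gamma>" .
      qed (use t in simp)
      also have "\<dots> = B * t powr k"
        unfolding tk B_def \<gamma>_def by (simp add: exp_of_nat_mult[symmetric] exp_add[symmetric] field_simps)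
      finally show ?thesis using t(1) by simp
    qed
    then obtain E' where E': "E' \<subseteq> E" "spread T n (\<delta> / 2) k E'" "real (card E) \<le> real (card E') * B"
      using spread_subset_card[OF nE(2), of "\<delta> / 2" k B T n] \<open>\<delta> > 0\<close> \<beta> by (auto simp: k_def B_def)
    have "exp (h' * real n) * B = exp (h * real n)"
      by (simp add: B_def exp_add[symmetric] algebra_simps)
    also have "\<dots> \<le> real (card E') * B" using nE(3) E'(3) by simp
    finally have "exp (h' * real n) \<le> real (card E')" by (simp add: B_def)
    then show "\<exists>n\<ge>N. \<exists>E. finite E \<and> exp (h' * real n) \<le> real (card E) \<and> spread T n (\<delta> / 2) (\<beta> * real n) E \<and>
        (\<forall>x\<in>E. norm (orbit_sum T \<Phi> n x - real n *\<^sub>R v) \<le> \<eta> * real n)"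
      using nE E' unfolding k_def
      by (intro exI[of _ n] conjI exI[of _ E']) (auto intro: finite_subset)
  qed
  then show ?thesis using that \<beta> by blast
qed

section \<open>Segments with nearly equal averages\<close>

text \<open>All averages lie in a compact ball. If every vector \<open>v\<close> had a neighbourhood in which the segments with
average there are fewer than \<open>exp (h' * n)\<close> for all large \<open>n\<close>, then finitely many of these
neighbourhoods would account for all segments, and there would be too few of them.\<close>
lemma rich_exists:
  fixes T :: "'a::metric_space \<Rightarrow> 'a" and \<Phi> :: "'a \<Rightarrow> 'b::euclidean_space"
  assumes \<Phi>: "\<And>x. norm (\<Phi> x) \<le> M" and "h' < h"
    and ent: "\<And>N. \<exists>n\<ge>N. \<exists>E. finite E \<and> exp (h * real n) \<le> real (card E) \<and> spread T n \<delta> 0 E"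
  obtains v where "rich T \<Phi> \<delta> 0 h' v"
proof (rule ccontr)
  assume "\<not> thesis"
  then have no: "\<And>v. \<not> rich T \<Phi> \<delta> 0 h' v" using that by blast
  define near where "near \<eta> n v x \<longleftrightarrow> norm (orbit_sum T \<Phi> n x - real n *\<^sub>R v) \<le> \<eta> * real n" for \<eta> n v x
  define poor where "poor v \<eta> N \<longleftrightarrow> \<eta> > 0 \<and> (\<forall>n\<ge>N. \<forall>E. finite E \<and> spread T n \<delta> 0 E \<and>
      (\<forall>x\<in>E. near \<eta> n v x) \<longrightarrow> real (card E) < exp (h' * real n))" for v \<eta> N
  have "\<exists>\<eta> N. poor v \<eta> N" for v
  proof (rule ccontr)
    assume np: "\<not> ?thesis"
    have "rich T \<Phi> \<delta> 0 h' v"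
      unfolding rich_def
    proof (intro allI impI)
      fix \<eta> :: real and N :: nat assume "\<eta> > 0"
      moreover have "\<not> poor v \<eta> N" using np by blast
      ultimately obtain n E where "n \<ge> N" "finite E" "spread T n \<delta> 0 E" "\<forall>x\<in>E. near \<eta> n v x"
        "exp (h' * real n) \<le> real (card E)" unfolding poor_def by (auto simp: not_less)
      then show "\<exists>n\<ge>N. \<exists>E. finite E \<and> exp (h' * real n) \<le> real (card E) \<and>
          spread T n \<delta> (0 * real n) E \<and>
          (\<forall>x\<in>E. norm (orbit_sum T \<Phi> n x - real n *\<^sub>R v) \<le> \<eta> * real n)"
        unfolding near_def by (intro exI[of _ n] conjI exI[of _ E]) auto
    qed
    then show False using no by blast
  qed
  then obtain \<eta> N where poor: "\<And>v. poor v (\<eta> v) (N v)" by metis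
  then have \<eta>: "\<And>v. \<eta> v > 0" by (simp add: poor_def)
  have N: "real (card E) < exp (h' * real n)"
    if "n \<ge> N v" "finite E" "spread T n \<delta> 0 E" "\<And>x. x \<in> E \<Longrightarrow> near (\<eta> v) n v x" for v n E
    using poor[of v, unfolded poor_def, THEN conjunct2, rule_format, of n E] that by blast
  obtain K where K: "finite K" "cball 0 M \<subseteq> (\<Union>v\<in>K. ball v (\<eta> v))"
  proof (rule compactE_image[of "cball 0 M" UNIV "\<lambda>v. ball v (\<eta> v)"])
    show "cball 0 M \<subseteq> (\<Union>v\<in>UNIV. ball v (\<eta> v))"
    proof
      fix v :: 'b
      have "v \<in> ball v (\<eta> v)" using \<eta>[of v] by simp
      then show "v \<in> (\<Union>v\<in>UNIV. ball v (\<eta> v))" by blast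
    qed
  qed simp_all
  have "LIM n sequentially. exp ((h - h') * real n) :> at_top"
    using \<open>h' < h\<close> by real_asymp
  then obtain N1 where N1: "\<And>n. n \<ge> N1 \<Longrightarrow> real (card K) < exp ((h - h') * real n)"
    by (auto simp: filterlim_at_top_dense eventually_sequentially)
  define N2 where "N2 = Max (insert 1 (insert N1 (N ` K)))"
  obtain n E where nE: "n \<ge> N2" "finite E" "exp (h * real n) \<le> real (card E)" "spread T n \<delta> 0 E"
    using ent[of N2] by blast
  have n: "n \<ge> 1" "n \<ge> N1" "\<And>v. v \<in> K \<Longrightarrow> n \<ge> N v"
  proof -
    have "m \<le> n" if "m \<in> insert 1 (insert N1 (N ` K))" for m
    proof -
      have "m \<le> N2" unfolding N2_def using K(1) that by (intro Max_ge) simp_all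
      then show ?thesis using nE(1) by simp
    qed
    then show "n \<ge> 1" "n \<ge> N1" "\<And>v. v \<in> K \<Longrightarrow> n \<ge> N v" by auto
  qed
  define A where "A v = {x\<in>E. near (\<eta> v) n v x}" for v
  have "E \<subseteq> (\<Union>v\<in>K. A v)"
  proof
    fix x assume "x \<in> E"
    define a where "a = (1 / real n) *\<^sub>R orbit_sum T \<Phi> n x"
    have "norm a \<le> M"
      using orbit_sum_bound[of \<Phi> M T n x, OF \<Phi>] n(1) by (simp add: a_def field_simps)
    then obtain v where v: "v \<in> K" "dist v a < \<eta> v" using K(2) by auto
    have "orbit_sum T \<Phi> n x - real n *\<^sub>R v = real n *\<^sub>R (a - v)"
      using n(1) by (simp add: a_def algebra_simps)
    then have "near (\<eta> v) n v x"
      using mult_left_mono[OF less_imp_le[OF v(2)], of "real n"]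
      by (simp add: near_def dist_norm norm_minus_commute mult.commute)
    then show "x \<in> (\<Union>v\<in>K. A v)" using v(1) \<open>x \<in> E\<close> by (auto simp: A_def)
  qed
  then have "card E \<le> card (\<Union>v\<in>K. A v)"
    using K(1) nE(2) by (intro card_mono) (auto simp: A_def)
  also have "\<dots> \<le> (\<Sum>v\<in>K. card (A v))" using K(1) by (rule card_UN_le)
  finally have "real (card E) \<le> (\<Sum>v\<in>K. real (card (A v)))" by (simp flip: of_nat_sum)
  also have "\<dots> \<le> (\<Sum>v\<in>K. exp (h' * real n))"
  proof (rule sum_mono)
    fix v assume "v \<in> K"
    then show "real (card (A v)) \<le> exp (h' * real n)"
      using nE(2,4) n(3) by (intro less_imp_le[OF N[of v]]) (auto simp: A_def spread_def)
  qed
  also have "\<dots> = real (card K) * exp (h' * real n)" by simp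
  also have "\<dots> < exp ((h - h') * real n) * exp (h' * real n)"
    using N1[OF n(2)] by (intro mult_strict_right_mono) auto
  also have "\<dots> = exp (h * real n)" by (simp add: exp_add[symmetric] algebra_simps)
  finally show False using nE(3) by simp
qed

section \<open>Mixing segments with a given orbit\<close>

lemma sum_two_phases:
  fixes a b :: "'b::real_vector"
  shows "(\<Sum>j<m + k. if j < m then a else b) = real m *\<^sub>R a + real k *\<^sub>R b"
proof (induction k)
  case 0
  have "(\<Sum>j<m. if j < m then a else b) = (\<Sum>j<m. a)" by (intro sum.cong) auto
  then show ?case by (simp add: sum_constant_scaleR)
next
  case (Suc k)
  then show ?case by (simp add: scaleR_left_distrib add.assoc)
qed

text \<open>Separation inside a block, in the form in which tracing provides it, separates the whole orbits.\<close>
lemma deviations_pos: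
  assumes "i < n" "l + n \<le> L" "dist ((T ^^ i) ((T ^^ l) y)) ((T ^^ i) ((T ^^ l) y')) > \<delta>"
  shows "0 < real (deviations T L \<delta> y y')"
proof -
  have "deviations T L \<delta> y y' \<noteq> 0"
    unfolding deviations_eq_0 using assms by (intro notI) (auto simp: funpow_shift dest!: spec[of _ "l + i"])
  then show ?thesis by simp
qed

text \<open>The hypothesis on \<open>u\<close> says that \<open>u\<close> is an accumulation point of the averages along the orbit of \<open>x\<^sub>0\<close>. The
new segments spend the proportion \<open>1 / (Q + 1)\<close> of their time near that orbit, which only costs the
factor \<open>Q / (Q + 1)\<close> in \<open>h\<close>, close to one for large \<open>Q\<close>.\<close>
lemma rich_mix:
  fixes T :: "'a::metric_space \<Rightarrow> 'a" and \<Phi> :: "'a \<Rightarrow> 'b::real_normed_vector"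
  assumes cpt: "compact (UNIV :: 'a set)" and \<Phi>: "continuous_on UNIV \<Phi>"
    and trc: "tracing_lengths T N\<^sub>0" and "\<delta> > 0" "\<beta> > 0"
    and rich: "rich T \<Phi> \<delta> \<beta> h v"
    and u: "\<And>\<eta> N. \<eta> > 0 \<Longrightarrow> \<exists>n\<ge>N. norm (orbit_sum T \<Phi> n x\<^sub>0 - real n *\<^sub>R u) \<le> \<eta> * real n"
  shows "rich T \<Phi> (\<delta> / 2) 0 (h * real Q / (real Q + 1)) ((1 / (real Q + 1)) *\<^sub>R (u + real Q *\<^sub>R v))"
  unfolding rich_def
proof (intro allI impI)
  fix \<eta> :: real and N :: nat assume "\<eta> > 0"
  obtain \<epsilon> where \<epsilon>: "0 < \<epsilon>" "\<epsilon> \<le> min (\<delta> / 4) (\<beta> / 2)"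
    and close: "\<And>T n x y. tracks T n \<epsilon> x y \<Longrightarrow> norm (orbit_sum T \<Phi> n y - orbit_sum T \<Phi> n x) \<le> real n * (\<eta> / 2)"
    using orbit_sum_tracks[OF cpt \<Phi>, of "\<eta> / 2" "min (\<delta> / 4) (\<beta> / 2)"] \<open>\<eta> > 0\<close> \<open>\<delta> > 0\<close> \<open>\<beta> > 0\<close> by auto
  have "\<eta> / 2 > 0" using \<open>\<eta> > 0\<close> by simp
  obtain n where n: "n \<ge> max N (max 1 (N\<^sub>0 \<epsilon>))" "norm (orbit_sum T \<Phi> n x\<^sub>0 - real n *\<^sub>R u) \<le> \<eta> / 2 * real n"
    using u[OF \<open>\<eta> / 2 > 0\<close>] by blast
  obtain m E where m: "m \<ge> max 1 (N\<^sub>0 \<epsilon>)" "finite E" "exp (h * real m) \<le> real (card E)"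
    "spread T m \<delta> (\<beta> * real m) E"
    "\<forall>x\<in>E. norm (orbit_sum T \<Phi> m x - real m *\<^sub>R v) \<le> \<eta> / 2 * real m"
    using rich[unfolded rich_def, rule_format, OF \<open>\<eta> / 2 > 0\<close>, of "max 1 (N\<^sub>0 \<epsilon>)"] by blast
  \<comment> \<open>\<open>m\<close> blocks of length \<open>n\<close> followed by \<open>n * Q\<close> blocks of length \<open>m\<close>: the time is divided exactly in
    the ratio \<open>1 : Q\<close>, whatever \<open>m\<close> and \<open>n\<close> are. The blocks after the first \<open>B\<close> are only there
    because tracing is formulated for infinite sequences.\<close>
  define B where "B = m + n * Q"
  define len where "len j = (if j < m then n else m)" for j
  define l where "l j = (\<Sum>i<j. len i)" for j
  define L where "L = m * n * (Q + 1)"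
  have lB: "l B = L"
  proof -
    have "real (l B) = (\<Sum>j<m + n * Q. if j < m then real n else real m)"
      unfolding l_def B_def len_def of_nat_sum by (intro sum.cong) auto
    also have "\<dots> = real L" by (simp add: sum_two_phases L_def algebra_simps)
    finally show ?thesis by simp
  qed
  have l_le: "l j + len j \<le> L" if "j < B" for j
  proof -
    have "l j + len j = l (Suc j)" by (simp add: l_def)
    also have "\<dots> \<le> l B" unfolding l_def using that by (intro sum_mono2) auto
    finally show ?thesis using lB by simp
  qed
  define W where "W = {m..<B} \<rightarrow>\<^sub>E E"
  define pt where "pt f j = (if m \<le> j \<and> j < B then f j else x\<^sub>0)" for f :: "nat \<Rightarrow> 'a" and j
  have "\<exists>z. \<forall>j. tracks T (len j) \<epsilon> (pt f j) ((T ^^ l j) z)" for f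
    unfolding l_def using m(1) n(1) \<epsilon>(1) by (intro tracing_lengthsD[OF trc]) (auto simp: len_def)
  then obtain z where z: "\<And>f j. tracks T (len j) \<epsilon> (pt f j) ((T ^^ l j) (z f))" by metis
  define tgt where "tgt j = (if j < m then u else v)" for j
  have L1: "L \<ge> N"
  proof -
    have "N \<le> n * 1" using n(1) by simp
    also have "\<dots> \<le> n * (m * (Q + 1))" using m(1) by (intro mult_le_mono2) simp
    also have "\<dots> = L" by (simp only: L_def mult_ac)
    finally show ?thesis .
  qed
  have avg: "norm (orbit_sum T \<Phi> L (z f) - real L *\<^sub>R ((1 / (real Q + 1)) *\<^sub>R (u + real Q *\<^sub>R v))) \<le> \<eta> * real L"
    if f: "f \<in> W" for f
  proof -
    have "norm (orbit_sum T \<Phi> (len j) ((T ^^ l j) (z f)) - real (len j) *\<^sub>R tgt j) \<le> real (len j) * \<eta>"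
      if "j < B" for j
    proof -
      have 1: "norm (orbit_sum T \<Phi> (len j) (pt f j) - real (len j) *\<^sub>R tgt j) \<le> real (len j) * (\<eta> / 2)"
        using n(2) m(5) f that by (auto simp: len_def pt_def tgt_def W_def PiE_iff mult.commute)
      have "norm (orbit_sum T \<Phi> (len j) ((T ^^ l j) (z f)) - real (len j) *\<^sub>R tgt j)
          \<le> real (len j) * (\<eta> / 2) + real (len j) * (\<eta> / 2)"
        using norm_triangle_mono[OF close[OF z[of j f]] 1] by simp
      then show ?thesis by (simp add: mult.commute)
    qed
    then have "norm (orbit_sum T \<Phi> (l B) (z f) - (\<Sum>j<B. real (len j) *\<^sub>R tgt j)) \<le> (\<Sum>j<B. real (len j) * \<eta>)"
      unfolding l_def by (intro orbit_sum_blocks) blast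
    also have "(\<Sum>j<B. real (len j) * \<eta>) = \<eta> * real (l B)"
      by (simp add: l_def sum_distrib_left mult.commute)
    also have "(\<Sum>j<B. real (len j) *\<^sub>R tgt j)
        = (\<Sum>j<m + n * Q. if j < m then real n *\<^sub>R u else real m *\<^sub>R v)"
      unfolding B_def by (intro sum.cong) (auto simp: len_def tgt_def)
    also have "\<dots> = real (m * n) *\<^sub>R u + real (m * n * Q) *\<^sub>R v"
      by (simp add: sum_two_phases mult_ac)
    also have "\<dots> = real L *\<^sub>R ((1 / (real Q + 1)) *\<^sub>R (u + real Q *\<^sub>R v))"
    proof -
      have "real L * (1 / (real Q + 1)) = real (m * n)"
        by (simp add: L_def field_simps)
      then have "real L *\<^sub>R ((1 / (real Q + 1)) *\<^sub>R (u + real Q *\<^sub>R v)) = real (m * n) *\<^sub>R (u + real Q *\<^sub>R v)"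
        by (simp only: scaleR_scaleR)
      then show ?thesis by (simp add: scaleR_right_distrib)
    qed
    finally show ?thesis using lB by simp
  qed
  have sep: "0 < real (deviations T L (\<delta> / 2) (z f) (z f'))" if "f \<in> W" "f' \<in> W" "f \<noteq> f'" for f f'
  proof -
    have "\<exists>j\<in>{m..<B}. f j \<noteq> f' j"
    proof (rule ccontr)
      assume "\<not> ?thesis"
      then have "f = f'" using that(1,2) unfolding W_def by (intro PiE_ext) auto
      then show False using that(3) by simp
    qed
    then obtain j where j: "j \<in> {m..<B}" "f j \<noteq> f' j" by blast
    have E: "f j \<in> E" "f' j \<in> E" using that j(1) by (auto simp: W_def)
    have dev: "\<beta> * real m < real (deviations T m \<delta> (f j) (f' j))"
      using m(4) E j(2) by (simp add: spread_def)
    have tr: "tracks T m \<epsilon> (f j) ((T ^^ l j) (z f))" "tracks T m \<epsilon> (f' j) ((T ^^ l j) (z f'))"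
      using z[of j f] z[of j f'] j(1) by (auto simp: len_def pt_def)
    obtain i where "i < m" "dist ((T ^^ i) ((T ^^ l j) (z f))) ((T ^^ i) ((T ^^ l j) (z f'))) > \<delta> / 2"
      using tracks_separated[OF dev tr] \<epsilon>(2) by auto
    then show ?thesis
      using l_le[of j] j(1) by (intro deviations_pos[of i m "l j"]) (auto simp: len_def)
  qed
  have inj: "inj_on z W"
  proof (rule inj_onI, rule ccontr)
    fix f f' assume "f \<in> W" "f' \<in> W" "z f = z f'" "f \<noteq> f'"
    then show False using sep[of f f'] \<open>\<delta> > 0\<close> by (simp add: deviations_self)
  qed
  have "finite W" unfolding W_def using m(2) by (intro finite_PiE) auto
  show "\<exists>n\<ge>N. \<exists>E. finite E \<and> exp (h * real Q / (real Q + 1) * real n) \<le> real (card E) \<and>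
      spread T n (\<delta> / 2) (0 * real n) E \<and>
      (\<forall>x\<in>E. norm (orbit_sum T \<Phi> n x - real n *\<^sub>R ((1 / (real Q + 1)) *\<^sub>R (u + real Q *\<^sub>R v))) \<le> \<eta> * real n)"
  proof (intro exI[of _ L] exI[of _ "z ` W"] conjI L1)
    show "finite (z ` W)" using \<open>finite W\<close> by simp
    show "spread T L (\<delta> / 2) (0 * real L) (z ` W)" using sep by (auto simp: spread_def)
    show "\<forall>x\<in>z ` W. norm (orbit_sum T \<Phi> L x - real L *\<^sub>R ((1 / (real Q + 1)) *\<^sub>R (u + real Q *\<^sub>R v))) \<le> \<eta> * real L"
      using avg by blast
    have "h * real Q / (real Q + 1) * real L = real (n * Q) * (h * real m)"
      by (simp add: L_def field_simps)
    then have "exp (h * real Q / (real Q + 1) * real L) = exp (h * real m) ^ (n * Q)"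
      by (simp only: exp_of_nat_mult)
    also have "\<dots> \<le> real (card E) ^ (n * Q)" using m(3) by (intro power_mono) auto
    also have "\<dots> = real (card (z ` W))"
      unfolding card_image[OF inj] by (simp add: W_def card_PiE B_def)
    finally show "exp (h * real Q / (real Q + 1) * real L) \<le> real (card (z ` W))" .
  qed
qed

section \<open>Entropy of an infinite concatenation\<close>

text \<open>Give the infinite product of the sets \<open>A j\<close> the product of the uniform probability measures. The
summands on the right bound the measures of cylinders that cover the whole product.\<close>
lemma cylinder_cover_weight:
  fixes A :: "nat \<Rightarrow> 'c set" and J :: "nat \<Rightarrow> nat"
  assumes A: "\<And>j. finite (A j)" "\<And>j. A j \<noteq> {}"
    and cover: "\<And>w. (\<And>j. w j \<in> A j) \<Longrightarrow> \<exists>i\<in>I. \<forall>j<J i. w j = u i j"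
  shows "1 \<le> (\<Sum>\<^sub>\<infinity>i\<in>I. ennreal (\<Prod>j<J i. 1 / real (card (A j))))"
proof -
  define M where "M j = uniform_count_measure (A j)" for j
  have M: "prob_space (M j)" for j
    unfolding M_def using A by (intro prob_space_uniform_count_measure)
  interpret product_prob_space M UNIV
    using M by (simp add: product_prob_space_def product_sigma_finite_def product_prob_space_axioms_def
        prob_space_imp_sigma_finite)
  let ?P = "PiM UNIV M"
  define X where "X i j = {u i j} \<inter> A j" for i j
  have X: "X i j \<in> sets (M j)" for i j by (simp add: X_def M_def sets_uniform_count_measure)
  define Cyl where "Cyl i = {w\<in>space ?P. \<forall>j\<in>{..<J i}. w j \<in> X i j}" for i
  have Cyl_sets: "Cyl i \<in> sets ?P" for i
  proof -
    have "{w \<in> space (M j). w \<in> X i j} = X i j" for j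
      by (auto simp: X_def M_def space_uniform_count_measure)
    then have "{w \<in> space (M j). w \<in> X i j} \<in> sets (M j)" for j using X by simp
    then show ?thesis
      unfolding Cyl_def by (intro sets.sets_Collect_finite_All sets_Collect_single') auto
  qed
  have Cyl_le: "emeasure ?P (Cyl i) \<le> ennreal (\<Prod>j<J i. 1 / real (card (A j)))" for i
  proof -
    have "emeasure ?P (Cyl i) = (\<Prod>j<J i. emeasure (M j) (X i j))"
      unfolding Cyl_def by (rule emeasure_PiM_Collect) (auto simp: X)
    also have "\<dots> = (\<Prod>j<J i. ennreal (real (card (X i j)) / real (card (A j))))"
      unfolding M_def using A(1) by (intro prod.cong refl emeasure_uniform_count_measure) (auto simp: X_def)
    also have "\<dots> = ennreal (\<Prod>j<J i. real (card (X i j)) / real (card (A j)))"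
      by (rule prod_ennreal) simp
    also have "\<dots> \<le> ennreal (\<Prod>j<J i. 1 / real (card (A j)))"
    proof (intro ennreal_leI prod_mono conjI divide_right_mono)
      fix j
      have "card (X i j) \<le> card {u i j}" unfolding X_def by (intro card_mono) auto
      then show "real (card (X i j)) \<le> 1" by simp
    qed simp_all
    finally show ?thesis .
  qed
  define C where "C i = (if i \<in> I then Cyl i else {})" for i
  have C_sets: "C i \<in> sets ?P" for i using Cyl_sets by (simp add: C_def)
  have "space ?P \<subseteq> (\<Union>i. C i)"
  proof
    fix w assume w: "w \<in> space ?P"
    then have wA: "w j \<in> A j" for j by (auto simp: space_PiM PiE_iff M_def space_uniform_count_measure)
    then obtain i where i: "i \<in> I" "\<forall>j<J i. w j = u i j" using cover by blast
    then have "u i j \<in> A j" if "j < J i" for j using wA[of j] that by simp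
    then have "w \<in> C i" using w i by (simp add: C_def Cyl_def X_def)
    then show "w \<in> (\<Union>i. C i)" by blast
  qed
  then have "emeasure ?P (space ?P) \<le> emeasure ?P (\<Union>i. C i)"
    using C_sets by (intro emeasure_mono) auto
  also have "\<dots> \<le> (\<Sum>i. emeasure ?P (C i))"
    using C_sets by (intro emeasure_subadditive_countably) auto
  also have "\<dots> \<le> (\<Sum>\<^sub>\<infinity>i\<in>I. ennreal (\<Prod>j<J i. 1 / real (card (A j))))"
  proof (rule suminf_le_const)
    fix n
    have "(\<Sum>i<n. emeasure ?P (C i)) \<le> (\<Sum>i<n. if i \<in> I then ennreal (\<Prod>j<J i. 1 / real (card (A j))) else 0)"
      using Cyl_le by (intro sum_mono) (simp add: C_def)
    also have "\<dots> = (\<Sum>i\<in>{..<n} \<inter> I. ennreal (\<Prod>j<J i. 1 / real (card (A j))))"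
      by (subst sum.inter_restrict[symmetric]) auto
    also have "\<dots> \<le> (\<Sum>\<^sub>\<infinity>i\<in>I. ennreal (\<Prod>j<J i. 1 / real (card (A j))))"
      by (rule ennreal_sum_le_infsum) auto
    finally show "(\<Sum>i<n. emeasure ?P (C i)) \<le> (\<Sum>\<^sub>\<infinity>i\<in>I. ennreal (\<Prod>j<J i. 1 / real (card (A j))))" .
  qed simp
  finally show ?thesis using emeasure_space_1 by simp
qed

lemma le_sum_pos:
  fixes \<nu> :: "nat \<Rightarrow> nat"
  assumes "\<And>j. \<nu> j \<ge> 1"
  shows "j \<le> (\<Sum>i<j. \<nu> i)"
  using sum_mono[of "{..<j}" "\<lambda>_. 1" \<nu>] assms by simp

text \<open>\<open>J n\<close> is the number of blocks that are completed by time \<open>n\<close>.\<close>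
lemma block_index:
  fixes \<nu> :: "nat \<Rightarrow> nat"
  assumes \<nu>: "\<And>j. \<nu> j \<ge> 1"
  defines "l \<equiv> \<lambda>j. \<Sum>i<j. \<nu> i"
  obtains J where "\<And>n. l (J n) \<le> n" "\<And>n. n < l (Suc (J n))" "filterlim J at_top sequentially"
proof -
  have lj: "j \<le> l j" for j
    unfolding l_def by (rule le_sum_pos) (rule \<nu>)
  have mono: "l i \<le> l j" if "i \<le> j" for i j
    unfolding l_def using that by (intro sum_mono2) auto
  define J where "J n = (LEAST j. n < l (Suc j))" for n
  have 1: "n < l (Suc (J n))" for n
    unfolding J_def by (rule LeastI[of _ n]) (use lj[of "Suc n"] in simp)
  have 2: "l (J n) \<le> n" for n
  proof (cases "J n")
    case 0 then show ?thesis by (simp add: l_def)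
  next
    case (Suc k)
    then have "k < (LEAST j. n < l (Suc j))" by (simp add: J_def)
    from not_less_Least[OF this] Suc show ?thesis by simp
  qed
  have "filterlim J at_top sequentially"
    unfolding filterlim_at_top
  proof (intro allI)
    fix K
    have "K \<le> J n" if "n \<ge> l K" for n
    proof (rule ccontr)
      assume "\<not> K \<le> J n"
      then have "l (Suc (J n)) \<le> l K" by (intro mono) simp
      then show False using 1[of n] that by simp
    qed
    then show "\<forall>\<^sub>F n in sequentially. K \<le> J n" by (auto simp: eventually_sequentially)
  qed
  then show ?thesis using that 1 2 by blast
qed

lemma infsum_cmult_ennreal:
  fixes f :: "'i \<Rightarrow> ennreal"
  shows "(\<Sum>\<^sub>\<infinity>i\<in>I. c * f i) = c * (\<Sum>\<^sub>\<infinity>i\<in>I. f i)"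
proof -
  show ?thesis
    by (simp add: nonneg_infsum_complete sum_distrib_left[symmetric] SUP_mult_left_ennreal)
qed

text \<open>A mass distribution principle. Points with different choices in some block are at distance more than \<open>\<delta>\<close>
within that block, so all parameters \<open>w\<close> whose points \<open>z w\<close> lie in one Bowen ball of radius \<open>\<delta> / 2\<close> and
length \<open>n\<close> belong to one cylinder, whose depth is the number of blocks completed by time \<open>n\<close>. Such a
cylinder has measure at most a constant times \<open>exp (- s * n)\<close>: blocks are short compared with the
preceding time, so the incomplete block costs less than the gap between \<open>s\<close> and \<open>h\<close>.\<close>
lemma bowen_C_nonzero_of_blocks:
  fixes \<nu> :: "nat \<Rightarrow> nat" and A :: "nat \<Rightarrow> 'c set" and z :: "(nat \<Rightarrow> 'c) \<Rightarrow> 'a::metric_space"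
  assumes \<nu>: "\<And>j. \<nu> j \<ge> 1"
  defines "l \<equiv> \<lambda>j. \<Sum>i<j. \<nu> i"
  assumes small: "(\<lambda>j. real (\<nu> j) / real (l j)) \<longlonglongrightarrow> 0"
    and A: "\<And>j. finite (A j)" "\<And>j. exp (h * real (\<nu> j)) \<le> real (card (A j))"
    and zZ: "\<And>w. (\<And>j. w j \<in> A j) \<Longrightarrow> z w \<in> Z"
    and sep: "\<And>w w' j. (\<And>i. w i \<in> A i) \<Longrightarrow> (\<And>i. w' i \<in> A i) \<Longrightarrow> w j \<noteq> w' j \<Longrightarrow>
      \<exists>i<\<nu> j. \<delta> < dist ((T ^^ i) ((T ^^ l j) (z w))) ((T ^^ i) ((T ^^ l j) (z w')))"
    and s: "0 \<le> s" "s < h"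
  shows "bowen_C T Z s (\<delta> / 2) \<noteq> 0"
proof -
  have Ane: "A j \<noteq> {}" for j
  proof
    assume "A j = {}"
    then show False using A(2)[of j] by (simp add: not_le)
  qed
  have mono: "l i \<le> l j" if "i \<le> j" for i j
    unfolding l_def using that by (intro sum_mono2) auto
  have lj: "j \<le> l j" for j
    unfolding l_def by (rule le_sum_pos) (rule \<nu>)
  have lSuc: "l (Suc j) = l j + \<nu> j" for j by (simp add: l_def)
  have "\<exists>J. (\<forall>n. l (J n) \<le> n) \<and> (\<forall>n. n < l (Suc (J n)))"
    unfolding l_def by (rule block_index[of \<nu>, OF \<nu>]) blast
  then obtain J where J: "\<And>n. l (J n) \<le> n" "\<And>n. n < l (Suc (J n))" by blast
  \<comment> \<open>The constant absorbs the finitely many initial blocks that are not yet short compared with the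
    preceding time.\<close>
  obtain c where c: "\<And>n. s * real n - h * real (l (J n)) \<le> c"
  proof -
    have "(\<lambda>j. s * (real (\<nu> j) / real (l j))) \<longlonglongrightarrow> s * 0" by (intro tendsto_mult small tendsto_const)
    then have "\<forall>\<^sub>F j in sequentially. s * (real (\<nu> j) / real (l j)) < h - s"
      using s(2) by (intro order_tendstoD(2)) auto
    then obtain j0 where j0: "\<And>j. j \<ge> j0 \<Longrightarrow> s * (real (\<nu> j) / real (l j)) < h - s"
      by (auto simp: eventually_sequentially)
    have "s * real n - h * real (l (J n)) \<le> s * real (l (Suc j0))" for n
    proof (cases "J n \<ge> Suc j0")
      case True
      then have lpos: "real (l (J n)) > 0" using lj[of "J n"] by simp
      have "s * real (\<nu> (J n)) \<le> (h - s) * real (l (J n))"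
        using j0[of "J n"] True lpos by (simp add: field_simps)
      moreover have "s * real n \<le> s * (real (l (J n)) + real (\<nu> (J n)))"
        using J(2)[of n] s(1) by (intro mult_left_mono) (auto simp: lSuc)
      ultimately have "s * real n - h * real (l (J n)) \<le> 0" by (simp add: algebra_simps)
      also have "\<dots> \<le> s * real (l (Suc j0))" using s(1) by simp
      finally show ?thesis .
    next
      case False
      then have "l (Suc (J n)) \<le> l (Suc j0)" by (intro mono) simp
      then have "s * real n \<le> s * real (l (Suc j0))" using J(2)[of n] s(1) by (intro mult_left_mono) auto
      moreover have "0 \<le> h * real (l (J n))" using s by simp
      ultimately show ?thesis by simp
    qed
    then show ?thesis using that by blast
  qed
  have "ennreal (exp (- c)) \<le> bowen_C_at T Z s (\<delta> / 2) 0"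
    unfolding bowen_C_at_def
  proof (rule Inf_greatest, safe)
    fix I x n assume "bowen_cover T Z (\<delta> / 2) 0 I x n"
    then have cov: "Z \<subseteq> (\<Union>i\<in>I. bowen_ball T (n i) (x i) (\<delta> / 2))" by (simp add: bowen_cover_def)
    \<comment> \<open>Any one parameter whose point lies in the ball determines its cylinder; if there is none, the ball
      covers nothing and an arbitrary cylinder may be assigned to it.\<close>
    define good where "good i w \<longleftrightarrow> (\<forall>j. w j \<in> A j) \<and> z w \<in> bowen_ball T (n i) (x i) (\<delta> / 2)" for i w
    define u where "u i = (SOME w. good i w)" for i
    have "1 \<le> (\<Sum>\<^sub>\<infinity>i\<in>I. ennreal (\<Prod>j<J (n i). 1 / real (card (A j))))"
    proof (rule cylinder_cover_weight[OF A(1) Ane])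
      fix w assume w: "\<And>j. w j \<in> A j"
      then obtain i where i: "i \<in> I" "z w \<in> bowen_ball T (n i) (x i) (\<delta> / 2)" using zZ cov by blast
      have "good i (u i)" unfolding u_def by (rule someI[of _ w]) (use w i in \<open>simp add: good_def\<close>)
      then have ui: "\<And>j. u i j \<in> A j" "z (u i) \<in> bowen_ball T (n i) (x i) (\<delta> / 2)" by (auto simp: good_def)
      have "w j = u i j" if "j < J (n i)" for j
      proof (rule ccontr)
        assume "w j \<noteq> u i j"
        then obtain k where k: "k < \<nu> j"
          "\<delta> < dist ((T ^^ k) ((T ^^ l j) (z w))) ((T ^^ k) ((T ^^ l j) (z (u i))))"
          using sep[of w "u i" j] w ui(1) by blast
        have "l j + k < l (Suc j)" using k(1) by (simp add: lSuc)
        also have "\<dots> \<le> l (J (n i))" using that by (intro mono) simp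
        also have "\<dots> \<le> n i" by (rule J(1))
        finally have "dist ((T ^^ (l j + k)) (x i)) ((T ^^ (l j + k)) (z w)) < \<delta> / 2"
          "dist ((T ^^ (l j + k)) (x i)) ((T ^^ (l j + k)) (z (u i))) < \<delta> / 2"
          using i(2) ui(2) by (auto simp: bowen_ball_def)
        then show False
          using k(2) dist_triangle3[of "(T ^^ (l j + k)) (z w)" "(T ^^ (l j + k)) (z (u i))" "(T ^^ (l j + k)) (x i)"]
          by (simp add: funpow_shift)
      qed
      then show "\<exists>i\<in>I. \<forall>j<J (n i). w j = u i j" using i(1) by blast
    qed
    also have "\<dots> \<le> (\<Sum>\<^sub>\<infinity>i\<in>I. ennreal (exp c) * ennreal (exp (- s * real (n i))))"
    proof (rule infsum_mono)
      fix i
      have "(\<Prod>j<J (n i). 1 / real (card (A j))) \<le> (\<Prod>j<J (n i). exp (- (h * real (\<nu> j))))"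
      proof (intro prod_mono conjI)
        fix j
        have "1 / real (card (A j)) \<le> 1 / exp (h * real (\<nu> j))"
          by (rule divide_left_mono[OF A(2)]) (use order_less_le_trans[OF exp_gt_zero A(2)] in simp_all)
        then show "1 / real (card (A j)) \<le> exp (- (h * real (\<nu> j)))" by (simp add: exp_minus inverse_eq_divide)
      qed simp
      also have "\<dots> = exp (- (h * real (l (J (n i)))))"
        by (simp add: exp_sum[symmetric] l_def sum_negf sum_distrib_left)
      also have "\<dots> \<le> exp (c + - s * real (n i))" using c[of "n i"] by simp
      also have "\<dots> = exp c * exp (- s * real (n i))" by (rule exp_add)
      finally show "ennreal (\<Prod>j<J (n i). 1 / real (card (A j))) \<le> ennreal (exp c) * ennreal (exp (- s * real (n i)))"
        by (simp add: ennreal_mult[symmetric] ennreal_leI)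
    qed (auto intro: nonneg_summable_on_complete)
    also have "\<dots> = ennreal (exp c) * (\<Sum>\<^sub>\<infinity>i\<in>I. ennreal (exp (- s * real (n i))))"
      by (rule infsum_cmult_ennreal)
    finally have "ennreal (exp (- c)) * 1
        \<le> ennreal (exp (- c)) * (ennreal (exp c) * (\<Sum>\<^sub>\<infinity>i\<in>I. ennreal (exp (- s * real (n i)))))"
      by (rule mult_left_mono) simp
    also have "\<dots> = (\<Sum>\<^sub>\<infinity>i\<in>I. ennreal (exp (- s * real (n i))))"
      by (simp add: mult.assoc[symmetric] ennreal_mult[symmetric] exp_add[symmetric])
    finally show "ennreal (exp (- c)) \<le> (\<Sum>\<^sub>\<infinity>i\<in>I. ennreal (exp (- s * real (n i))))" by simp
  qed
  also have "\<dots> \<le> bowen_C T Z s (\<delta> / 2)" unfolding bowen_C_eq_SUP by (rule SUP_upper) simp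
  finally have "0 < bowen_C T Z s (\<delta> / 2)" by (rule order_less_le_trans[rotated]) simp
  then show ?thesis by simp
qed

section \<open>Concatenation in stages\<close>

text \<open>The pair consists of the index of the first block of stage \<open>k\<close> and the time at which that block
starts; stage \<open>k\<close> consists of \<open>r\<close> blocks of length \<open>n k\<close>. The factor \<open>n (Suc k) + t\<close> in \<open>r\<close> makes the stage
long compared both with a block of the next stage and with all the time before.\<close>
primrec stage_start :: "(nat \<Rightarrow> nat) \<Rightarrow> nat \<Rightarrow> nat \<times> nat" where
  "stage_start n 0 = (0, 0)"
| "stage_start n (Suc k) =
     (let (s, t) = stage_start n k; r = Suc k * (n (Suc k) + t) in (s + r, t + r * n k))"

text \<open>\<open>\<kappa> j\<close> is the stage to which block \<open>j\<close> belongs, and \<open>s k\<close> is the first block of stage \<open>k\<close>. The third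
property says that blocks are short compared with the preceding time, the last one that each stage
outweighs everything before it.\<close>
lemma stage_schedule:
  fixes n :: "nat \<Rightarrow> nat"
  assumes n: "\<And>k. n k \<ge> 1"
  obtains \<kappa> s :: "nat \<Rightarrow> nat" where
    "filterlim \<kappa> at_top sequentially" "strict_mono s"
    "\<And>j. \<kappa> j * n (\<kappa> j) \<le> (\<Sum>i<j. n (\<kappa> i))"
    "\<And>k j. s k \<le> j \<Longrightarrow> j < s (Suc k) \<Longrightarrow> \<kappa> j = k"
    "\<And>k. Suc k * (\<Sum>i<s k. n (\<kappa> i)) \<le> (\<Sum>i<s (Suc k). n (\<kappa> i))"
proof -
  define s where "s k = fst (stage_start n k)" for k
  define t where "t k = snd (stage_start n k)" for k
  define r where "r k = Suc k * (n (Suc k) + t k)" for k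
  have s0: "s 0 = 0" "t 0 = 0" by (simp_all add: s_def t_def)
  have sS: "s (Suc k) = s k + r k" and tS: "t (Suc k) = t k + r k * n k" for k
    by (simp_all add: s_def t_def r_def Let_def split: prod.split)
  have r1: "r k \<ge> 1" for k using n[of "Suc k"] by (simp add: r_def)
  have sm: "strict_mono s" by (rule strict_mono_Suc_iff[THEN iffD2]) (use r1 sS in \<open>simp add: Suc_le_eq\<close>)
  have sk: "k \<le> s k" for k by (rule strict_mono_imp_increasing[OF sm])
  have smono: "s i \<le> s k" if "i \<le> k" for i k using sm that by (simp add: strict_mono_less_eq)
  define \<kappa> where "\<kappa> j = (LEAST k. j < s (Suc k))" for j
  have \<kappa>1: "j < s (Suc (\<kappa> j))" for j
    unfolding \<kappa>_def by (rule LeastI[of _ j]) (use sk[of "Suc j"] in simp)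
  have \<kappa>2: "s (\<kappa> j) \<le> j" for j
  proof (cases "\<kappa> j")
    case 0 then show ?thesis by (simp add: s0)
  next
    case (Suc k)
    then have "k < (LEAST k. j < s (Suc k))" by (simp add: \<kappa>_def)
    from not_less_Least[OF this] Suc show ?thesis by simp
  qed
  have \<kappa>eq: "\<kappa> j = k" if "s k \<le> j" "j < s (Suc k)" for j k
    unfolding \<kappa>_def
  proof (rule Least_equality)
    fix y assume "j < s (Suc y)"
    then have "s k < s (Suc y)" using that(1) by simp
    then show "k \<le> y" using sm by (simp add: strict_mono_less)
  qed (rule that)
  define l where "l j = (\<Sum>i<j. n (\<kappa> i))" for j
  have lt: "l (s k) = t k" for k
  proof (induction k)
    case 0 then show ?case by (simp add: s0 l_def)
  next
    case (Suc k)
    have "l (s (Suc k)) = l (s k) + (\<Sum>i\<in>{s k..<s (Suc k)}. n (\<kappa> i))"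
      unfolding l_def lessThan_atLeast0 using smono[of k "Suc k"] by (subst sum.atLeastLessThan_concat) auto
    also have "(\<Sum>i\<in>{s k..<s (Suc k)}. n (\<kappa> i)) = (\<Sum>i\<in>{s k..<s (Suc k)}. n k)"
      using \<kappa>eq by (intro sum.cong) auto
    finally show ?case using Suc by (simp add: sS tS)
  qed
  have lmono: "l i \<le> l j" if "i \<le> j" for i j
    unfolding l_def using that by (intro sum_mono2) auto
  have tn: "k * n k \<le> t k" for k
  proof (cases k)
    case (Suc k')
    have "Suc k' * n (Suc k') * 1 \<le> (Suc k' * (n (Suc k') + t k')) * n k'"
      using n[of k'] by (intro mult_le_mono) auto
    then show ?thesis using Suc by (simp add: tS r_def)
  qed simp
  have tt: "Suc k * t k \<le> t (Suc k)" for k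
  proof -
    have "Suc k * t k * 1 \<le> (Suc k * (n (Suc k) + t k)) * n k"
      using n[of k] by (intro mult_le_mono) auto
    then show ?thesis by (simp add: tS r_def)
  qed
  show ?thesis
  proof (rule that[OF _ sm])
    show "filterlim \<kappa> at_top sequentially"
      unfolding filterlim_at_top
    proof (intro allI)
      fix K
      have "K \<le> \<kappa> j" if "j \<ge> s K" for j
      proof (rule ccontr)
        assume "\<not> K \<le> \<kappa> j"
        then have "s (Suc (\<kappa> j)) \<le> s K" by (intro smono) simp
        then show False using \<kappa>1[of j] that by simp
      qed
      then show "\<forall>\<^sub>F j in sequentially. K \<le> \<kappa> j" by (auto simp: eventually_sequentially)
    qed
    show "\<kappa> j * n (\<kappa> j) \<le> (\<Sum>i<j. n (\<kappa> i))" for j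
      using tn[of "\<kappa> j"] lt[of "\<kappa> j"] lmono[OF \<kappa>2[of j]] by (simp add: l_def)
    show "\<kappa> j = k" if "s k \<le> j" "j < s (Suc k)" for k j by (rule \<kappa>eq[OF that])
    show "Suc k * (\<Sum>i<s k. n (\<kappa> i)) \<le> (\<Sum>i<s (Suc k). n (\<kappa> i))" for k
      using tt[of k] lt[of k] lt[of "Suc k"] by (simp add: l_def)
  qed
qed

lemma weighted_average_tendsto_0:
  fixes w :: "nat \<Rightarrow> nat" and \<theta> :: "nat \<Rightarrow> real"
  assumes w: "\<And>j. w j \<ge> 1" and \<theta>: "\<theta> \<longlonglongrightarrow> 0" "\<And>j. 0 \<le> \<theta> j"
  shows "(\<lambda>j. (\<Sum>i<j. real (w i) * \<theta> i) / real (\<Sum>i<j. w i)) \<longlonglongrightarrow> 0"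
proof (rule LIMSEQ_I)
  fix e :: real assume "e > 0"
  define l where "l j = (\<Sum>i<j. w i)" for j
  have lj: "j \<le> l j" for j
    unfolding l_def by (rule le_sum_pos) (rule w)
  have "\<forall>\<^sub>F i in sequentially. \<theta> i < e / 2" using \<open>e > 0\<close> by (intro order_tendstoD(2)[OF \<theta>(1)]) simp
  then obtain N where N: "\<And>i. i \<ge> N \<Longrightarrow> \<theta> i < e / 2" by (auto simp: eventually_sequentially)
  \<comment> \<open>The contribution of the finitely many weights with large \<open>\<theta>\<close>; it disappears as the total weight grows.\<close>
  define C where "C = (\<Sum>i<N. real (w i) * \<theta> i)"
  have bound: "(\<Sum>i<j. real (w i) * \<theta> i) \<le> C + e / 2 * real (l j)" for j
  proof -
    have "(\<Sum>i<j. real (w i) * \<theta> i) \<le> (\<Sum>i<j. (if i < N then real (w i) * \<theta> i else 0) + e / 2 * real (w i))"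
    proof (rule sum_mono)
      fix i
      show "real (w i) * \<theta> i \<le> (if i < N then real (w i) * \<theta> i else 0) + e / 2 * real (w i)"
        using N[of i] mult_left_mono[of "\<theta> i" "e / 2" "real (w i)"] \<open>e > 0\<close> by (auto simp: mult.commute)
    qed
    also have "\<dots> = (\<Sum>i\<in>{..<j} \<inter> {..<N}. real (w i) * \<theta> i) + e / 2 * real (l j)"
      by (simp add: sum.distrib l_def sum_distrib_left sum.inter_restrict)
    also have "(\<Sum>i\<in>{..<j} \<inter> {..<N}. real (w i) * \<theta> i) \<le> C"
      unfolding C_def using \<theta>(2) by (intro sum_mono2) auto
    finally show ?thesis by simp
  qed
  obtain N1 :: nat where N1: "2 * C / e < real N1" using reals_Archimedean2 by blast
  have "norm ((\<Sum>i<j. real (w i) * \<theta> i) / real (l j) - 0) < e" if "j \<ge> max 1 N1" for j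
  proof -
    have l: "real (l j) > 0" "2 * C / e < real (l j)" using lj[of j] that N1 by auto
    have "(\<Sum>i<j. real (w i) * \<theta> i) < e / 2 * real (l j) + e / 2 * real (l j)"
      using bound[of j] l(2) \<open>e > 0\<close> by (simp add: field_simps)
    then have "(\<Sum>i<j. real (w i) * \<theta> i) / real (l j) < e" using l(1) by (simp add: field_simps)
    moreover have "0 \<le> (\<Sum>i<j. real (w i) * \<theta> i) / real (l j)"
      using \<theta>(2) by (intro divide_nonneg_nonneg sum_nonneg mult_nonneg_nonneg) auto
    ultimately show ?thesis by simp
  qed
  then show "\<exists>no. \<forall>j\<ge>no. norm ((\<Sum>i<j. real (w i) * \<theta> i) / real (\<Sum>i<j. w i) - 0) < e"
    unfolding l_def by blast
qed

lemma block_averages: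
  fixes \<nu> :: "nat \<Rightarrow> nat" and \<Phi> :: "'a \<Rightarrow> 'b::real_normed_vector"
  assumes \<nu>: "\<And>j. \<nu> j \<ge> 1" and \<theta>: "\<theta> \<longlonglongrightarrow> 0" "\<And>j. 0 \<le> \<theta> j"
  defines "l \<equiv> \<lambda>j. \<Sum>i<j. \<nu> i"
  assumes blk: "\<And>j. norm (orbit_sum T \<Phi> (\<nu> j) ((T ^^ l j) z) - real (\<nu> j) *\<^sub>R t j) \<le> real (\<nu> j) * \<theta> j"
  shows "(\<lambda>j. norm (orbit_sum T \<Phi> (l j) z - (\<Sum>i<j. real (\<nu> i) *\<^sub>R t i)) / real (l j)) \<longlonglongrightarrow> 0"
proof (rule tendsto_sandwich[OF _ _ tendsto_const])
  show "(\<lambda>j. (\<Sum>i<j. real (\<nu> i) * \<theta> i) / real (l j)) \<longlonglongrightarrow> 0"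
    unfolding l_def by (rule weighted_average_tendsto_0[OF \<nu> \<theta>])
  have "norm (orbit_sum T \<Phi> (l j) z - (\<Sum>i<j. real (\<nu> i) *\<^sub>R t i)) \<le> (\<Sum>i<j. real (\<nu> i) * \<theta> i)" for j
    unfolding l_def by (rule orbit_sum_blocks) (use blk in \<open>simp add: l_def\<close>)
  then show "\<forall>\<^sub>F j in sequentially. norm (orbit_sum T \<Phi> (l j) z - (\<Sum>i<j. real (\<nu> i) *\<^sub>R t i)) / real (l j)
      \<le> (\<Sum>i<j. real (\<nu> i) * \<theta> i) / real (l j)"
    by (intro always_eventually allI divide_right_mono) auto
qed simp

text \<open>With the same target \<open>p\<close> for all blocks, the averages at block ends tend to \<open>p\<close>; between block ends
they change little, because an incomplete block is short compared with the preceding time.\<close>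
lemma averages_converge_of_blocks:
  fixes \<nu> :: "nat \<Rightarrow> nat" and \<Phi> :: "'a \<Rightarrow> 'b::real_normed_vector"
  assumes \<nu>: "\<And>j. \<nu> j \<ge> 1" and \<theta>: "\<theta> \<longlonglongrightarrow> 0" "\<And>j. 0 \<le> \<theta> j"
  defines "l \<equiv> \<lambda>j. \<Sum>i<j. \<nu> i"
  assumes small: "(\<lambda>j. real (\<nu> j) / real (l j)) \<longlonglongrightarrow> 0"
    and M: "\<And>x. norm (\<Phi> x) \<le> M"
    and blk: "\<And>j. norm (orbit_sum T \<Phi> (\<nu> j) ((T ^^ l j) z) - real (\<nu> j) *\<^sub>R p) \<le> real (\<nu> j) * \<theta> j"
  shows "(\<lambda>n. (1 / real n) *\<^sub>R orbit_sum T \<Phi> n z) \<longlonglongrightarrow> p"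
proof -
  have "\<exists>J. (\<forall>n. l (J n) \<le> n) \<and> (\<forall>n. n < l (Suc (J n))) \<and> filterlim J at_top sequentially"
    unfolding l_def by (rule block_index[of \<nu>, OF \<nu>]) blast
  then obtain J where J: "\<And>n. l (J n) \<le> n" "\<And>n. n < l (Suc (J n))" "filterlim J at_top sequentially"
    by blast
  have lj: "j \<le> l j" for j
    unfolding l_def by (rule le_sum_pos) (rule \<nu>)
  define e where "e j = norm (orbit_sum T \<Phi> (l j) z - real (l j) *\<^sub>R p) / real (l j)" for j
  have "(\<lambda>j. norm (orbit_sum T \<Phi> (l j) z - (\<Sum>i<j. real (\<nu> i) *\<^sub>R p)) / real (l j)) \<longlonglongrightarrow> 0"
    unfolding l_def by (rule block_averages[OF \<nu> \<theta>]) (use blk in \<open>simp add: l_def\<close>)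
  moreover have "e = (\<lambda>j. norm (orbit_sum T \<Phi> (l j) z - (\<Sum>i<j. real (\<nu> i) *\<^sub>R p)) / real (l j))"
    by (simp add: fun_eq_iff e_def l_def scaleR_sum_left)
  ultimately have e: "e \<longlonglongrightarrow> 0" by simp
  define b where "b j = e j + (M + norm p) * (real (\<nu> j) / real (l j))" for j
  have "b \<longlonglongrightarrow> 0 + (M + norm p) * 0"
    unfolding b_def by (intro tendsto_add e tendsto_mult tendsto_const small)
  then have b: "(\<lambda>n. b (J n)) \<longlonglongrightarrow> 0" using filterlim_compose[OF _ J(3)] by force
  have bound: "norm ((1 / real n) *\<^sub>R orbit_sum T \<Phi> n z - p) \<le> b (J n)" if "J n \<ge> 1" for n
  proof -
    define L where "L = l (J n)"
    define d where "d = n - L"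
    have nd: "n = L + d" using J(1)[of n] by (simp add: d_def L_def)
    have Lpos: "L > 0" using lj[of "J n"] that by (simp add: L_def)
    have dn: "d \<le> \<nu> (J n)" using J(2)[of n] by (simp add: d_def L_def l_def)
    have "M \<ge> 0" using M norm_ge_zero order_trans by blast
    have "orbit_sum T \<Phi> n z - real n *\<^sub>R p
        = (orbit_sum T \<Phi> L z - real L *\<^sub>R p) + (orbit_sum T \<Phi> d ((T ^^ L) z) - real d *\<^sub>R p)"
      by (simp add: nd orbit_sum_add scaleR_left_distrib)
    also have "norm \<dots> \<le> e (J n) * real L + (M * real d + real d * norm p)"
    proof (intro norm_triangle_mono)
      show "norm (orbit_sum T \<Phi> L z - real L *\<^sub>R p) \<le> e (J n) * real L"
        using Lpos by (simp add: e_def L_def)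
      show "norm (orbit_sum T \<Phi> d ((T ^^ L) z) - real d *\<^sub>R p) \<le> M * real d + real d * norm p"
        using norm_triangle_ineq4[of "orbit_sum T \<Phi> d ((T ^^ L) z)" "real d *\<^sub>R p"]
          orbit_sum_bound[of \<Phi> M T d "(T ^^ L) z", OF M] by simp
    qed
    also have "\<dots> = e (J n) * real L + (M + norm p) * real d" by (simp add: algebra_simps)
    also have "\<dots> \<le> e (J n) * real L + (M + norm p) * real (\<nu> (J n))"
      using dn \<open>M \<ge> 0\<close> by (intro add_left_mono mult_left_mono) auto
    also have "\<dots> = b (J n) * real L"
      using Lpos by (simp add: b_def L_def field_simps)
    also have "\<dots> \<le> b (J n) * real n"
    proof (rule mult_left_mono)
      show "0 \<le> b (J n)" using \<open>M \<ge> 0\<close> by (simp add: b_def e_def)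
    qed (simp add: nd)
    finally have *: "norm (orbit_sum T \<Phi> n z - real n *\<^sub>R p) \<le> b (J n) * real n" .
    have npos: "real n > 0" using nd Lpos by simp
    have "(1 / real n) *\<^sub>R orbit_sum T \<Phi> n z - p = (1 / real n) *\<^sub>R (orbit_sum T \<Phi> n z - real n *\<^sub>R p)"
      using npos by (simp add: scaleR_diff_right)
    then have "norm ((1 / real n) *\<^sub>R orbit_sum T \<Phi> n z - p) = norm (orbit_sum T \<Phi> n z - real n *\<^sub>R p) / real n"
      by simp
    also have "\<dots> \<le> b (J n)" using * npos by (simp add: field_simps)
    finally show ?thesis .
  qed
  have "(\<lambda>n. (1 / real n) *\<^sub>R orbit_sum T \<Phi> n z - p) \<longlonglongrightarrow> 0"
  proof (rule Lim_null_comparison[OF _ b])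
    show "\<forall>\<^sub>F n in sequentially. norm ((1 / real n) *\<^sub>R orbit_sum T \<Phi> n z - p) \<le> b (J n)"
      using J(3)[unfolded filterlim_at_top, rule_format, of 1] by eventually_elim (rule bound)
  qed
  then show ?thesis by (rule LIM_zero_cancel)
qed

text \<open>At its end, stage \<open>k\<close> has taken up all but a proportion \<open>1 / (k + 1)\<close> of the time, so its target
\<open>v k\<close> dominates.\<close>
lemma averages_at_stage_ends:
  fixes \<nu> :: "nat \<Rightarrow> nat" and \<Phi> :: "'a \<Rightarrow> 'b::real_normed_vector"
  assumes \<nu>: "\<And>j. \<nu> j \<ge> 1" and \<theta>: "\<theta> \<longlonglongrightarrow> 0" "\<And>j. 0 \<le> \<theta> j"
  defines "l \<equiv> \<lambda>j. \<Sum>i<j. \<nu> i"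
  assumes s: "strict_mono s" "\<And>k. Suc k * l (s k) \<le> l (s (Suc k))"
    and tv: "\<And>k j. s k \<le> j \<Longrightarrow> j < s (Suc k) \<Longrightarrow> t j = v k"
    and M: "\<And>j. norm (t j) \<le> M" "\<And>k. norm (v k) \<le> M"
    and blk: "\<And>j. norm (orbit_sum T \<Phi> (\<nu> j) ((T ^^ l j) z) - real (\<nu> j) *\<^sub>R t j) \<le> real (\<nu> j) * \<theta> j"
  shows "(\<lambda>k. (1 / real (l (s (Suc k)))) *\<^sub>R orbit_sum T \<Phi> (l (s (Suc k))) z - v k) \<longlonglongrightarrow> 0"
proof -
  have lj: "j \<le> l j" for j
    unfolding l_def by (rule le_sum_pos) (rule \<nu>)
  define a where "a j = norm (orbit_sum T \<Phi> (l j) z - (\<Sum>i<j. real (\<nu> i) *\<^sub>R t i)) / real (l j)" for j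
  have "a \<longlonglongrightarrow> 0"
    unfolding a_def l_def by (rule block_averages[OF \<nu> \<theta>]) (use blk in \<open>simp add: l_def\<close>)
  moreover have "filterlim (\<lambda>k. s (Suc k)) at_top sequentially"
    using filterlim_compose[OF filterlim_subseq[OF s(1)] filterlim_Suc] by (simp add: o_def)
  ultimately have a: "(\<lambda>k. a (s (Suc k))) \<longlonglongrightarrow> 0" by (rule filterlim_compose)
  have lim: "(\<lambda>k. a (s (Suc k)) + 2 * M * (1 / real (Suc k))) \<longlonglongrightarrow> 0 + 2 * M * 0"
    using LIMSEQ_inverse_real_of_nat by (intro tendsto_add a tendsto_mult tendsto_const) (simp add: inverse_eq_divide)
  have M0: "M \<ge> 0" using M(1) norm_ge_zero order_trans by blast
  have bound: "norm ((1 / real (l (s (Suc k)))) *\<^sub>R orbit_sum T \<Phi> (l (s (Suc k))) z - v k)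
      \<le> a (s (Suc k)) + 2 * M * (1 / real (Suc k))" for k
  proof -
    define L where "L = l (s (Suc k))"
    define L' where "L' = l (s k)"
    have ss: "s k \<le> s (Suc k)" using s(1) by (simp add: strict_mono_less_eq)
    have "s (Suc k) > 0" using strict_mono_imp_increasing[OF s(1), of "Suc k"] by simp
    then have Lpos: "L > 0" using lj[of "s (Suc k)"] by (simp add: L_def)
    have "(\<Sum>i<s (Suc k). real (\<nu> i) *\<^sub>R t i) - real L *\<^sub>R v k = (\<Sum>i<s (Suc k). real (\<nu> i) *\<^sub>R (t i - v k))"
      by (simp add: L_def l_def scaleR_sum_left sum_subtractf scaleR_diff_right)
    also have "\<dots> = (\<Sum>i<s k. real (\<nu> i) *\<^sub>R (t i - v k)) + (\<Sum>i\<in>{s k..<s (Suc k)}. real (\<nu> i) *\<^sub>R (t i - v k))"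
      unfolding lessThan_atLeast0 using ss by (subst sum.atLeastLessThan_concat) auto
    also have "(\<Sum>i\<in>{s k..<s (Suc k)}. real (\<nu> i) *\<^sub>R (t i - v k)) = 0"
      using tv by (intro sum.neutral) auto
    finally have "(\<Sum>i<s (Suc k). real (\<nu> i) *\<^sub>R t i) - real L *\<^sub>R v k
        = (\<Sum>i<s k. real (\<nu> i) *\<^sub>R (t i - v k))" by simp
    then have "norm ((\<Sum>i<s (Suc k). real (\<nu> i) *\<^sub>R t i) - real L *\<^sub>R v k)
        \<le> (\<Sum>i<s k. norm (real (\<nu> i) *\<^sub>R (t i - v k)))" by (simp only: norm_sum)
    also have "\<dots> \<le> (\<Sum>i<s k. real (\<nu> i) * (2 * M))"
    proof (rule sum_mono)
      fix i
      have "norm (t i - v k) \<le> 2 * M" using norm_triangle_ineq4[of "t i" "v k"] M(1)[of i] M(2)[of k] by simp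
      then show "norm (real (\<nu> i) *\<^sub>R (t i - v k)) \<le> real (\<nu> i) * (2 * M)"
        by (simp add: mult_left_mono)
    qed
    also have "\<dots> = 2 * M * real L'" by (simp add: L'_def l_def sum_distrib_left mult.commute)
    also have "\<dots> \<le> 2 * M * (real L / real (Suc k))"
    proof (rule mult_left_mono)
      have "real (Suc k * L') \<le> real L" using s(2)[of k] unfolding L_def L'_def by (rule of_nat_mono)
      then show "real L' \<le> real L / real (Suc k)" by (simp add: field_simps)
    qed (use M0 in simp)
    finally have 2: "norm ((\<Sum>i<s (Suc k). real (\<nu> i) *\<^sub>R t i) - real L *\<^sub>R v k) \<le> 2 * M * (real L / real (Suc k))" .
    have 1: "norm (orbit_sum T \<Phi> L z - (\<Sum>i<s (Suc k). real (\<nu> i) *\<^sub>R t i)) \<le> a (s (Suc k)) * real L"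
      using Lpos by (simp add: a_def L_def)
    have "norm (orbit_sum T \<Phi> L z - real L *\<^sub>R v k) \<le> a (s (Suc k)) * real L + 2 * M * (real L / real (Suc k))"
      using norm_triangle_mono[OF 1 2] by simp
    also have "\<dots> = (a (s (Suc k)) + 2 * M * (1 / real (Suc k))) * real L" by (simp add: algebra_simps)
    finally have *: "norm (orbit_sum T \<Phi> L z - real L *\<^sub>R v k) \<le> (a (s (Suc k)) + 2 * M * (1 / real (Suc k))) * real L" .
    have "(1 / real L) *\<^sub>R orbit_sum T \<Phi> L z - v k = (1 / real L) *\<^sub>R (orbit_sum T \<Phi> L z - real L *\<^sub>R v k)"
      using Lpos by (simp add: scaleR_diff_right)
    then have "norm ((1 / real L) *\<^sub>R orbit_sum T \<Phi> L z - v k) = norm (orbit_sum T \<Phi> L z - real L *\<^sub>R v k) / real L"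
      by simp
    also have "\<dots> \<le> a (s (Suc k)) + 2 * M * (1 / real (Suc k))"
      using divide_right_mono[OF *, of "real L"] Lpos by simp
    finally show ?thesis unfolding L_def .
  qed
  show ?thesis
    by (rule Lim_null_comparison[OF always_eventually]) (use bound lim in simp_all)
qed

section \<open>Regular and irregular points\<close>

lemma birkhoff_avg_orbit_sum: "birkhoff_avg T \<phi> n x = (1 / real n) *\<^sub>R orbit_sum T \<phi> n x"
  by (simp add: birkhoff_avg_def orbit_sum_def)

lemma regular_setI:
  assumes "(\<lambda>n. birkhoff_avg T \<phi> n x) \<longlonglongrightarrow> p"
  shows "x \<in> regular_set T \<phi>"
proof -
  have "(\<lambda>n. ereal (birkhoff_avg T \<phi> n x)) \<longlonglongrightarrow> ereal p" using assms by simp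
  then have "lower_avg T \<phi> x = ereal p" "upper_avg T \<phi> x = ereal p"
    unfolding lower_avg_def upper_avg_def by (simp_all add: lim_imp_Liminf lim_imp_Limsup)
  then show ?thesis by (simp add: regular_set_def)
qed

lemma lower_le_upper_avg: "lower_avg T \<phi> x \<le> upper_avg T \<phi> x"
  unfolding lower_avg_def upper_avg_def by (rule Liminf_le_Limsup) simp

text \<open>Otherwise the averages would converge in the extended reals, and all their subsequences to the same limit.\<close>
lemma irregular_setI:
  assumes "(\<lambda>k. birkhoff_avg T \<phi> (m k) x) \<longlonglongrightarrow> p" "filterlim m at_top sequentially"
    and "(\<lambda>k. birkhoff_avg T \<phi> (m' k) x) \<longlonglongrightarrow> p'" "filterlim m' at_top sequentially"
    and "p \<noteq> p'"
  shows "x \<in> irregular_set T \<phi>"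
proof (rule ccontr)
  assume "x \<notin> irregular_set T \<phi>"
  then have eq: "lower_avg T \<phi> x = upper_avg T \<phi> x"
    using lower_le_upper_avg[of T \<phi> x] by (simp add: irregular_set_def)
  define L where "L = upper_avg T \<phi> x"
  have lim: "(\<lambda>n. ereal (birkhoff_avg T \<phi> n x)) \<longlonglongrightarrow> L"
    using eq by (intro Liminf_eq_Limsup) (simp_all add: L_def lower_avg_def upper_avg_def)
  have "(\<lambda>k. ereal (birkhoff_avg T \<phi> (m k) x)) \<longlonglongrightarrow> ereal p" using assms(1) by simp
  then have 1: "ereal p = L" using filterlim_compose[OF lim assms(2)] LIMSEQ_unique by blast
  have "(\<lambda>k. ereal (birkhoff_avg T \<phi> (m' k) x)) \<longlonglongrightarrow> ereal p'" using assms(3) by simp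
  then have 2: "ereal p' = L" using filterlim_compose[OF lim assms(4)] LIMSEQ_unique by blast
  have "ereal p = ereal p'" by (rule trans[OF 1 2[symmetric]])
  then show False using \<open>p \<noteq> p'\<close> by simp
qed

lemma avg_bounds:
  assumes "\<And>y. \<bar>\<phi> y\<bar> \<le> M"
  shows "\<bar>birkhoff_avg T \<phi> n x\<bar> \<le> M"
proof -
  have "M \<ge> 0" using assms[of x] by linarith
  then show ?thesis
    using orbit_sum_bound[of \<phi> M T n x] assms
    by (cases "n = 0") (auto simp: birkhoff_avg_orbit_sum abs_mult field_simps)
qed

lemma real_limits_of_avg:
  assumes "\<And>y. \<bar>\<phi> y\<bar> \<le> M"
  obtains a b where "lower_avg T \<phi> x = ereal a" "upper_avg T \<phi> x = ereal b"
proof -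
  have b: "- M \<le> birkhoff_avg T \<phi> n x" "birkhoff_avg T \<phi> n x \<le> M" for n
    using avg_bounds[of \<phi> M T n x, OF assms] by linarith+
  have "ereal (- M) \<le> lower_avg T \<phi> x"
    unfolding lower_avg_def by (rule Liminf_bounded) (use b in simp)
  moreover have "upper_avg T \<phi> x \<le> ereal M"
    unfolding upper_avg_def by (rule Limsup_bounded) (use b in simp)
  ultimately have "\<bar>lower_avg T \<phi> x\<bar> \<noteq> \<infinity>" "\<bar>upper_avg T \<phi> x\<bar> \<noteq> \<infinity>"
    using lower_le_upper_avg[of T \<phi> x] by (cases "lower_avg T \<phi> x"; cases "upper_avg T \<phi> x"; simp)+
  then show ?thesis using that by (metis ereal_real')
qed

lemma regular_setD:
  assumes "\<And>y. \<bar>\<phi> y\<bar> \<le> M" "x \<in> regular_set T \<phi>"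
  obtains a where "(\<lambda>n. birkhoff_avg T \<phi> n x) \<longlonglongrightarrow> a"
proof -
  obtain a b where ab: "lower_avg T \<phi> x = ereal a" "upper_avg T \<phi> x = ereal b"
    using real_limits_of_avg[of \<phi> M T x] assms(1) by blast
  have "(\<lambda>n. ereal (birkhoff_avg T \<phi> n x)) \<longlonglongrightarrow> ereal a"
    using assms(2) ab by (intro Liminf_eq_Limsup) (simp_all add: regular_set_def lower_avg_def upper_avg_def)
  then show ?thesis using that by simp
qed

lemma irregular_setD:
  assumes "\<And>y. \<bar>\<phi> y\<bar> \<le> M" "x \<in> irregular_set T \<phi>"
  obtains a b r r' where "a \<noteq> b" "strict_mono r" "strict_mono r'"
    "(\<lambda>k. birkhoff_avg T \<phi> (r k) x) \<longlonglongrightarrow> a" "(\<lambda>k. birkhoff_avg T \<phi> (r' k) x) \<longlonglongrightarrow> b"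
proof -
  obtain a b where ab: "lower_avg T \<phi> x = ereal a" "upper_avg T \<phi> x = ereal b"
    using real_limits_of_avg[of \<phi> M T x] assms(1) by blast
  obtain r where r: "strict_mono r" "((\<lambda>n. ereal (birkhoff_avg T \<phi> n x)) \<circ> r) \<longlonglongrightarrow> lower_avg T \<phi> x"
    unfolding lower_avg_def using liminf_subseq_lim by blast
  obtain r' where r': "strict_mono r'" "((\<lambda>n. ereal (birkhoff_avg T \<phi> n x)) \<circ> r') \<longlonglongrightarrow> upper_avg T \<phi> x"
    unfolding upper_avg_def using limsup_subseq_lim by blast
  have "a \<noteq> b" using assms(2) ab by (simp add: irregular_set_def)
  then show ?thesis using that[of a b r r'] r r' ab by (simp add: o_def)
qed

lemma orbit_sum_Pair:
  "orbit_sum T (\<lambda>x. (\<phi>\<^sub>1 x, \<phi>\<^sub>2 x)) n x = (orbit_sum T \<phi>\<^sub>1 n x, orbit_sum T \<phi>\<^sub>2 n x)"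
  unfolding orbit_sum_def by (induction n) (simp_all add: zero_prod_def)

lemma cluster_average:
  assumes "(\<lambda>k. birkhoff_avg T \<phi>\<^sub>1 (r k) x) \<longlonglongrightarrow> a" "(\<lambda>k. birkhoff_avg T \<phi>\<^sub>2 (r k) x) \<longlonglongrightarrow> b"
    and r: "strict_mono (r :: nat \<Rightarrow> nat)" and "\<eta> > 0"
  shows "\<exists>n\<ge>N. norm (orbit_sum T (\<lambda>x. (\<phi>\<^sub>1 x, \<phi>\<^sub>2 x)) n x - real n *\<^sub>R (a, b)) \<le> \<eta> * real n"
proof -
  have "(\<lambda>k. (birkhoff_avg T \<phi>\<^sub>1 (r k) x, birkhoff_avg T \<phi>\<^sub>2 (r k) x)) \<longlonglongrightarrow> (a, b)"
    by (intro tendsto_Pair assms)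
  from LIMSEQ_D[OF this \<open>\<eta> > 0\<close>] obtain k0 where k0: "\<And>k. k \<ge> k0 \<Longrightarrow>
    norm ((birkhoff_avg T \<phi>\<^sub>1 (r k) x, birkhoff_avg T \<phi>\<^sub>2 (r k) x) - (a, b)) < \<eta>" by blast
  define k where "k = max k0 (max N 1)"
  have rk: "r k \<ge> k" by (rule strict_mono_imp_increasing[OF r])
  then have pos: "r k \<ge> N" "real (r k) > 0" by (auto simp: k_def)
  have "orbit_sum T (\<lambda>x. (\<phi>\<^sub>1 x, \<phi>\<^sub>2 x)) (r k) x - real (r k) *\<^sub>R (a, b)
      = real (r k) *\<^sub>R ((birkhoff_avg T \<phi>\<^sub>1 (r k) x, birkhoff_avg T \<phi>\<^sub>2 (r k) x) - (a, b))"
    using pos(2) by (simp add: orbit_sum_Pair birkhoff_avg_orbit_sum right_diff_distrib)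
  then have "norm (orbit_sum T (\<lambda>x. (\<phi>\<^sub>1 x, \<phi>\<^sub>2 x)) (r k) x - real (r k) *\<^sub>R (a, b))
      = real (r k) * norm ((birkhoff_avg T \<phi>\<^sub>1 (r k) x, birkhoff_avg T \<phi>\<^sub>2 (r k) x) - (a, b))"
    by (simp only: norm_scaleR abs_of_nat)
  also have "\<dots> \<le> real (r k) * \<eta>"
    using k0[of k] by (intro mult_left_mono) (auto simp: k_def)
  finally show ?thesis using pos(1) by (intro exI[of _ "r k"]) (simp add: mult.commute)
qed

lemma top_entropy_geI:
  assumes "Z \<noteq> {}" "\<epsilon> > 0" and C: "\<And>s. 0 \<le> s \<Longrightarrow> s < h \<Longrightarrow> bowen_C T Z s \<epsilon> \<noteq> 0"
  shows "ereal h \<le> top_entropy T Z"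
proof -
  have "ereal h \<le> entropy_at T Z \<epsilon>"
    unfolding entropy_at_def
  proof (rule Inf_greatest, safe)
    fix s assume s: "bowen_C T Z s \<epsilon> = 0"
    have "h \<le> s"
    proof (rule ccontr)
      assume "\<not> h \<le> s"
      then show False
        using C[of s] bowen_C_nonzero_nonpos[OF assms(1), of s T \<epsilon>] s by (cases "0 \<le> s") auto
    qed
    then show "ereal h \<le> ereal s" by simp
  qed
  also have "\<dots> \<le> top_entropy T Z" unfolding top_entropy_eq_SUP using assms(2) by (intro SUP_upper) simp
  finally show ?thesis .
qed

section \<open>Full entropy of the regular-irregular set\<close>

text \<open>The concatenation in stages alternates between segments with averages near \<open>v\<^sub>0\<close> and near \<open>v\<^sub>1\<close>. These agree
in the first coordinate and differ in the second, so \<open>\<phi>\<^sub>1\<close> has convergent and \<open>\<phi>\<^sub>2\<close> oscillating averages.\<close>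
lemma bowen_C_nonzero_of_rich:
  fixes T :: "'a::metric_space \<Rightarrow> 'a" and \<phi>\<^sub>1 \<phi>\<^sub>2 :: "'a \<Rightarrow> real"
  assumes cpt: "compact (UNIV :: 'a set)"
    and \<phi>: "continuous_on UNIV \<phi>\<^sub>1" "continuous_on UNIV \<phi>\<^sub>2"
    and trc: "tracing_lengths T N\<^sub>0" and "\<delta> > 0" "\<beta> > 0"
    and rich: "rich T (\<lambda>x. (\<phi>\<^sub>1 x, \<phi>\<^sub>2 x)) \<delta> \<beta> h v\<^sub>0" "rich T (\<lambda>x. (\<phi>\<^sub>1 x, \<phi>\<^sub>2 x)) \<delta> \<beta> h v\<^sub>1"
    and v: "fst v\<^sub>0 = fst v\<^sub>1" "snd v\<^sub>0 \<noteq> snd v\<^sub>1"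
    and s: "0 \<le> s" "s < h"
  shows "bowen_C T (regular_set T \<phi>\<^sub>1 \<inter> irregular_set T \<phi>\<^sub>2) s (\<delta> / 4) \<noteq> 0"
proof -
  define \<Phi> where "\<Phi> = (\<lambda>x. (\<phi>\<^sub>1 x, \<phi>\<^sub>2 x))"
  have \<Phi>: "continuous_on UNIV \<Phi>" unfolding \<Phi>_def by (intro continuous_on_Pair \<phi>)
  have "bounded (range \<Phi>)" by (rule compact_imp_bounded[OF compact_continuous_image[OF \<Phi> cpt]])
  then obtain M where M: "\<And>x. norm (\<Phi> x) \<le> M" unfolding bounded_iff by auto
  have M1: "norm (\<phi>\<^sub>1 x) \<le> M" for x
    using norm_fst_le[of "\<phi>\<^sub>1 x" "\<phi>\<^sub>2 x"] M[of x] by (simp add: \<Phi>_def)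
  define v where "v k = (if even k then v\<^sub>0 else v\<^sub>1)" for k :: nat
  have vr: "rich T \<Phi> \<delta> \<beta> h (v k)" for k using rich by (simp add: v_def \<Phi>_def)
  \<comment> \<open>A segment length and a set of segments suitable for stage \<open>k\<close>: tracing with precision \<open>\<epsilon>\<close> preserves
    their separation and keeps their averages within \<open>1 / (k + 1)\<close> of the target.\<close>
  define ok where "ok k \<epsilon> n E \<longleftrightarrow> 0 < \<epsilon> \<and> \<epsilon> \<le> \<delta> / 4 \<and> \<epsilon> \<le> \<beta> / 2 \<and> n \<ge> 1 \<and> n \<ge> N\<^sub>0 \<epsilon> \<and>
      finite E \<and> exp (h * real n) \<le> real (card E) \<and> spread T n \<delta> (\<beta> * real n) E \<and>
      (\<forall>x\<in>E. \<forall>y. tracks T n \<epsilon> x y \<longrightarrow>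
        norm (orbit_sum T \<Phi> n y - real n *\<^sub>R v k) \<le> real n * (1 / real (Suc k)))" for k \<epsilon> n E
  have "\<exists>\<epsilon> n E. ok k \<epsilon> n E" for k
  proof -
    define \<theta> where "\<theta> = 1 / (2 * real (Suc k))"
    have \<theta>: "\<theta> > 0" "1 / real (Suc k) = \<theta> + \<theta>" by (simp_all add: \<theta>_def field_simps)
    obtain \<epsilon> where \<epsilon>: "0 < \<epsilon>" "\<epsilon> \<le> min (\<delta> / 4) (\<beta> / 2)"
      and close: "\<And>T n x y. tracks T n \<epsilon> x y \<Longrightarrow> norm (orbit_sum T \<Phi> n y - orbit_sum T \<Phi> n x) \<le> real n * \<theta>"
      using orbit_sum_tracks[OF cpt \<Phi> \<theta>(1), of "min (\<delta> / 4) (\<beta> / 2)"] \<open>\<delta> > 0\<close> \<open>\<beta> > 0\<close> by auto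
    obtain n E where nE: "n \<ge> max 1 (N\<^sub>0 \<epsilon>)" "finite E" "exp (h * real n) \<le> real (card E)"
      "spread T n \<delta> (\<beta> * real n) E"
      "\<forall>x\<in>E. norm (orbit_sum T \<Phi> n x - real n *\<^sub>R v k) \<le> \<theta> * real n"
      using vr[of k, unfolded rich_def, rule_format, OF \<theta>(1), of "max 1 (N\<^sub>0 \<epsilon>)"] by blast
    have "norm (orbit_sum T \<Phi> n y - real n *\<^sub>R v k) \<le> real n * (1 / real (Suc k))"
      if "x \<in> E" "tracks T n \<epsilon> x y" for x y
    proof -
      have "norm (orbit_sum T \<Phi> n x - real n *\<^sub>R v k) \<le> \<theta> * real n" using nE(5) that(1) by blast
      from norm_triangle_mono[OF close[OF that(2)] this] show ?thesis
        unfolding \<theta>(2) by (simp add: algebra_simps)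
    qed
    then have "ok k \<epsilon> n E" unfolding ok_def using \<epsilon> nE by simp
    then show ?thesis by blast
  qed
  then obtain \<epsilon> n E where ok: "\<And>k. ok k (\<epsilon> k) (n k) (E k)" by metis
  have n1: "n k \<ge> 1" for k using ok[of k] by (simp add: ok_def)
  obtain \<kappa> st where \<kappa>: "filterlim \<kappa> at_top sequentially" "strict_mono st"
    "\<And>j. \<kappa> j * n (\<kappa> j) \<le> (\<Sum>i<j. n (\<kappa> i))"
    "\<And>k j. st k \<le> j \<Longrightarrow> j < st (Suc k) \<Longrightarrow> \<kappa> j = k"
    "\<And>k. Suc k * (\<Sum>i<st k. n (\<kappa> i)) \<le> (\<Sum>i<st (Suc k). n (\<kappa> i))"
    using stage_schedule[of n, OF n1] by blast
  define \<nu> where "\<nu> j = n (\<kappa> j)" for j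
  define l where "l j = (\<Sum>i<j. \<nu> i)" for j
  define \<theta> where "\<theta> j = 1 / real (Suc (\<kappa> j))" for j
  have \<nu>: "\<nu> j \<ge> 1" for j using n1 by (simp add: \<nu>_def)
  have \<theta>: "\<theta> \<longlonglongrightarrow> 0" "\<And>j. 0 \<le> \<theta> j"
  proof -
    have "(\<lambda>k. 1 / real (Suc k)) \<longlonglongrightarrow> 0" using LIMSEQ_inverse_real_of_nat by (simp add: inverse_eq_divide)
    from filterlim_compose[OF this \<kappa>(1)] show "\<theta> \<longlonglongrightarrow> 0" by (simp add: \<theta>_def[abs_def])
  qed (simp add: \<theta>_def)
  have small: "(\<lambda>j. real (\<nu> j) / real (l j)) \<longlonglongrightarrow> 0"
  proof (rule Lim_null_comparison)
    show "(\<lambda>j. 2 * \<theta> j) \<longlonglongrightarrow> 0" using tendsto_mult[OF tendsto_const \<theta>(1), of 2] by simp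
    have "norm (real (\<nu> j) / real (l j)) \<le> 2 * \<theta> j" if "\<kappa> j \<ge> 1" for j
    proof -
      have "Suc (\<kappa> j) * \<nu> j \<le> (2 * \<kappa> j) * \<nu> j" using that by (intro mult_le_mono1) simp
      also have "\<dots> \<le> 2 * l j" using \<kappa>(3)[of j] by (simp add: \<nu>_def l_def)
      finally have "real (Suc (\<kappa> j) * \<nu> j) \<le> real (2 * l j)" by (rule of_nat_mono)
      then have *: "real (Suc (\<kappa> j)) * real (\<nu> j) \<le> 2 * real (l j)"
        by (simp only: of_nat_mult of_nat_numeral)
      have "real (\<nu> j) > 0" using \<nu>[of j] by simp
      then have "0 < real (Suc (\<kappa> j)) * real (\<nu> j)" by simp
      then have "real (l j) > 0" using * by linarith
      then show ?thesis using * by (simp add: \<theta>_def divide_simps mult.commute del: of_nat_Suc)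
    qed
    then show "\<forall>\<^sub>F j in sequentially. norm (real (\<nu> j) / real (l j)) \<le> 2 * \<theta> j"
      using \<kappa>(1)[unfolded filterlim_at_top, rule_format, of 1] by (rule eventually_mono[rotated])
  qed
  define A where "A j = E (\<kappa> j)" for j
  have "\<exists>z. \<forall>j. tracks T (\<nu> j) (\<epsilon> (\<kappa> j)) (w j) ((T ^^ l j) z)" for w
    unfolding l_def by (rule tracing_lengthsD[OF trc]) (use ok in \<open>simp_all add: ok_def \<nu>_def\<close>)
  then obtain z where z: "\<And>w j. tracks T (\<nu> j) (\<epsilon> (\<kappa> j)) (w j) ((T ^^ l j) (z w))" by metis
  have Z: "z w \<in> regular_set T \<phi>\<^sub>1 \<inter> irregular_set T \<phi>\<^sub>2" if w: "\<And>j. w j \<in> A j" for w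
  proof
    have blk: "norm (orbit_sum T \<Phi> (\<nu> j) ((T ^^ l j) (z w)) - real (\<nu> j) *\<^sub>R v (\<kappa> j)) \<le> real (\<nu> j) * \<theta> j" for j
      using ok[of "\<kappa> j"] w[of j] z[of j w] by (simp add: ok_def A_def \<nu>_def \<theta>_def)
    have v1: "fst (v k) = fst v\<^sub>0" for k using v(1) by (simp add: v_def)
    have blk1: "norm (orbit_sum T \<phi>\<^sub>1 (\<nu> j) ((T ^^ l j) (z w)) - real (\<nu> j) *\<^sub>R fst v\<^sub>0) \<le> real (\<nu> j) * \<theta> j"
      and blk2: "norm (orbit_sum T \<phi>\<^sub>2 (\<nu> j) ((T ^^ l j) (z w)) - real (\<nu> j) *\<^sub>R snd (v (\<kappa> j))) \<le> real (\<nu> j) * \<theta> j" for j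
    proof -
      let ?d = "orbit_sum T \<Phi> (\<nu> j) ((T ^^ l j) (z w)) - real (\<nu> j) *\<^sub>R v (\<kappa> j)"
      have nf: "norm (fst ?d) \<le> norm ?d" and ns: "norm (snd ?d) \<le> norm ?d"
        using norm_fst_le[of "fst ?d" "snd ?d"] norm_snd_le[of "snd ?d" "fst ?d"] unfolding prod.collapse by this+
      have e1: "fst ?d = orbit_sum T \<phi>\<^sub>1 (\<nu> j) ((T ^^ l j) (z w)) - real (\<nu> j) *\<^sub>R fst v\<^sub>0"
        by (simp add: \<Phi>_def orbit_sum_Pair v1)
      then show "norm (orbit_sum T \<phi>\<^sub>1 (\<nu> j) ((T ^^ l j) (z w)) - real (\<nu> j) *\<^sub>R fst v\<^sub>0) \<le> real (\<nu> j) * \<theta> j"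
        using order_trans[OF nf blk[of j]] unfolding e1 by simp
      have e2: "snd ?d = orbit_sum T \<phi>\<^sub>2 (\<nu> j) ((T ^^ l j) (z w)) - real (\<nu> j) *\<^sub>R snd (v (\<kappa> j))"
        by (simp add: \<Phi>_def orbit_sum_Pair)
      then show "norm (orbit_sum T \<phi>\<^sub>2 (\<nu> j) ((T ^^ l j) (z w)) - real (\<nu> j) *\<^sub>R snd (v (\<kappa> j))) \<le> real (\<nu> j) * \<theta> j"
        using order_trans[OF ns blk[of j]] unfolding e2 by simp
    qed
    have "(\<lambda>n. (1 / real n) *\<^sub>R orbit_sum T \<phi>\<^sub>1 n (z w)) \<longlonglongrightarrow> fst v\<^sub>0"
      by (rule averages_converge_of_blocks[OF \<nu> \<theta> small[unfolded l_def] M1 blk1[unfolded l_def]])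
    then show "z w \<in> regular_set T \<phi>\<^sub>1"
      by (intro regular_setI) (simp only: birkhoff_avg_orbit_sum)
    \<comment> \<open>The ends of the stages; even stages have target \<open>v\<^sub>0\<close> and odd ones \<open>v\<^sub>1\<close>.\<close>
    define m where "m k = l (st (Suc k))" for k
    define M' where "M' = max (norm (snd v\<^sub>0)) (norm (snd v\<^sub>1))"
    have lim: "(\<lambda>k. (1 / real (m k)) *\<^sub>R orbit_sum T \<phi>\<^sub>2 (m k) (z w) - snd (v k)) \<longlonglongrightarrow> 0"
      unfolding m_def l_def
    proof (rule averages_at_stage_ends[OF \<nu> \<theta> \<kappa>(2), where t = "\<lambda>j. snd (v (\<kappa> j))" and M = M'])
      show "Suc k * (\<Sum>i<st k. \<nu> i) \<le> (\<Sum>i<st (Suc k). \<nu> i)" for k using \<kappa>(5)[of k] by (simp add: \<nu>_def)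
      show "snd (v (\<kappa> j)) = snd (v k)" if "st k \<le> j" "j < st (Suc k)" for k j using \<kappa>(4)[OF that] by simp
      show "norm (snd (v (\<kappa> j))) \<le> M'" for j by (simp add: v_def M'_def)
      show "norm (snd (v k)) \<le> M'" for k by (simp add: v_def M'_def)
    qed (use blk2 in \<open>simp add: l_def\<close>)
    have lj: "j \<le> l j" for j
      unfolding l_def by (rule le_sum_pos) (rule \<nu>)
    have mk: "k \<le> m k" for k
      using strict_mono_imp_increasing[OF \<kappa>(2), of "Suc k"] lj[of "st (Suc k)"] by (simp add: m_def)
    have mlim: "filterlim (\<lambda>k. m (f k)) at_top sequentially" if "strict_mono f" for f
    proof -
      have "k \<le> m (f k)" for k using mk[of "f k"] strict_mono_imp_increasing[OF that, of k] by simp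
      then show ?thesis by (intro filterlim_at_top_mono[OF filterlim_ident]) simp
    qed
    have sub: "(\<lambda>k. birkhoff_avg T \<phi>\<^sub>2 (m (f k)) (z w)) \<longlonglongrightarrow> q"
      if f: "strict_mono f" "\<And>k. snd (v (f k)) = q" for f q
    proof -
      have "(\<lambda>k. (1 / real (m (f k))) *\<^sub>R orbit_sum T \<phi>\<^sub>2 (m (f k)) (z w) - snd (v (f k))) \<longlonglongrightarrow> 0"
        by (rule filterlim_compose[OF lim filterlim_subseq[OF f(1)]])
      then show ?thesis unfolding f(2) birkhoff_avg_orbit_sum by (rule LIM_zero_cancel)
    qed
    have f: "strict_mono (\<lambda>k :: nat. 2 * k)" "strict_mono (\<lambda>k :: nat. 2 * k + 1)"
      by (simp_all add: strict_mono_def)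
    show "z w \<in> irregular_set T \<phi>\<^sub>2"
      by (rule irregular_setI[OF sub[OF f(1)] mlim[OF f(1)] sub[OF f(2)] mlim[OF f(2)] v(2)])
        (simp_all add: v_def)
  qed
  have sep: "\<exists>i<\<nu> j. \<delta> / 2 < dist ((T ^^ i) ((T ^^ l j) (z w))) ((T ^^ i) ((T ^^ l j) (z w')))"
    if "\<And>i. w i \<in> A i" "\<And>i. w' i \<in> A i" "w j \<noteq> w' j" for w w' j
  proof (rule tracks_separated[OF _ z z])
    show "\<beta> * real (\<nu> j) < real (deviations T (\<nu> j) \<delta> (w j) (w' j))"
      using ok[of "\<kappa> j"] that by (simp add: ok_def spread_def A_def \<nu>_def)
  qed (use ok[of "\<kappa> j"] in \<open>simp_all add: ok_def\<close>)
  have A: "finite (A j)" "exp (h * real (\<nu> j)) \<le> real (card (A j))" for j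
    using ok[of "\<kappa> j"] by (simp_all add: ok_def A_def \<nu>_def)
  have "bowen_C T (regular_set T \<phi>\<^sub>1 \<inter> irregular_set T \<phi>\<^sub>2) s (\<delta> / 2 / 2) \<noteq> 0"
    by (rule bowen_C_nonzero_of_blocks[OF \<nu> small[unfolded l_def] A Z sep[unfolded l_def] s])
  then show ?thesis by simp
qed

theorem theorem1p1:
  fixes T :: "'a::metric_space \<Rightarrow> 'a" and \<phi>\<^sub>1 \<phi>\<^sub>2 :: "'a \<Rightarrow> real"
  assumes "compact (UNIV :: 'a set)"
    and "continuous_on UNIV T"
    and "almost_specification T"
    and "continuous_on UNIV \<phi>\<^sub>1"
    and "continuous_on UNIV \<phi>\<^sub>2"
  shows "regular_set T \<phi>\<^sub>1 \<inter> irregular_set T \<phi>\<^sub>2 = {} \<or>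
         top_entropy T (regular_set T \<phi>\<^sub>1 \<inter> irregular_set T \<phi>\<^sub>2) = top_entropy T UNIV"
proof (rule disjCI)
  let ?Z = "regular_set T \<phi>\<^sub>1 \<inter> irregular_set T \<phi>\<^sub>2"
  assume "top_entropy T ?Z \<noteq> top_entropy T UNIV"
  moreover have "top_entropy T ?Z \<le> top_entropy T UNIV" by (rule top_entropy_mono) simp
  ultimately have less: "top_entropy T ?Z < top_entropy T UNIV" by simp
  show "?Z = {}"
  proof (rule ccontr)
    assume ne: "?Z \<noteq> {}"
    then obtain x\<^sub>0 where x\<^sub>0: "x\<^sub>0 \<in> regular_set T \<phi>\<^sub>1" "x\<^sub>0 \<in> irregular_set T \<phi>\<^sub>2" by blast
    obtain N\<^sub>0 where trc: "tracing_lengths T N\<^sub>0"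
      by (rule almost_specification_tracks[OF assms(1-3)])
    define \<Phi> where "\<Phi> = (\<lambda>x. (\<phi>\<^sub>1 x, \<phi>\<^sub>2 x))"
    have \<Phi>: "continuous_on UNIV \<Phi>" unfolding \<Phi>_def by (intro continuous_on_Pair assms)
    have "bounded (range \<Phi>)" by (rule compact_imp_bounded[OF compact_continuous_image[OF \<Phi> assms(1)]])
    then obtain M where M: "\<And>x. norm (\<Phi> x) \<le> M" unfolding bounded_iff by auto
    have M1: "\<bar>\<phi>\<^sub>1 x\<bar> \<le> M" and M2: "\<bar>\<phi>\<^sub>2 x\<bar> \<le> M" for x
      using norm_fst_le[of "\<phi>\<^sub>1 x" "\<phi>\<^sub>2 x"] norm_snd_le[of "\<phi>\<^sub>2 x" "\<phi>\<^sub>1 x"] M[of x] by (simp_all add: \<Phi>_def)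
    obtain a where a: "(\<lambda>n. birkhoff_avg T \<phi>\<^sub>1 n x\<^sub>0) \<longlonglongrightarrow> a"
      by (rule regular_setD[OF M1 x\<^sub>0(1)])
    obtain b b' r r' where b: "b \<noteq> b'" and r: "strict_mono r" "strict_mono r'"
      and lim: "(\<lambda>k. birkhoff_avg T \<phi>\<^sub>2 (r k) x\<^sub>0) \<longlonglongrightarrow> b" "(\<lambda>k. birkhoff_avg T \<phi>\<^sub>2 (r' k) x\<^sub>0) \<longlonglongrightarrow> b'"
      by (rule irregular_setD[OF M2 x\<^sub>0(2)])
    have u: "\<exists>n\<ge>N. norm (orbit_sum T \<Phi> n x\<^sub>0 - real n *\<^sub>R (a, b)) \<le> \<eta> * real n"
      and u': "\<exists>n\<ge>N. norm (orbit_sum T \<Phi> n x\<^sub>0 - real n *\<^sub>R (a, b')) \<le> \<eta> * real n" if "\<eta> > 0" for \<eta> N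
      unfolding \<Phi>_def
      using cluster_average[OF filterlim_compose[OF a filterlim_subseq[OF r(1)]] lim(1) r(1) that]
        cluster_average[OF filterlim_compose[OF a filterlim_subseq[OF r(2)]] lim(2) r(2) that] by blast+
    obtain h where h: "top_entropy T ?Z < ereal h" "ereal h < top_entropy T UNIV"
      using ereal_dense2[OF less] by blast
    obtain h\<^sub>0 where h\<^sub>0: "h < h\<^sub>0" "ereal h\<^sub>0 < top_entropy T UNIV"
      using ereal_dense2[OF h(2)] by auto
    have "ereal 0 \<le> top_entropy T ?Z" by (rule top_entropy_geI[OF ne zero_less_one]) simp
    then have "ereal 0 < ereal h" using h(1) by (rule order_le_less_trans)
    then have hpos: "h > 0" by simp
    \<comment> \<open>Each improvement of richness lowers the exponent: \<open>h\<^sub>0\<close> comes from the entropy of the space, \<open>h\<^sub>1\<close> is left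
      after equalising averages, \<open>h\<^sub>2\<close> after thinning, \<open>h\<^sub>3\<close> after mixing and \<open>h\<^sub>4\<close> after thinning again. The last one must
      still exceed \<open>h\<close>; for mixing this is achieved by a large \<open>Q\<close>.\<close>
    define h\<^sub>2 where "h\<^sub>2 = (h + h\<^sub>0) / 2"
    define h\<^sub>1 where "h\<^sub>1 = (h\<^sub>2 + h\<^sub>0) / 2"
    have hs: "h < h\<^sub>2" "h\<^sub>2 < h\<^sub>1" "h\<^sub>1 < h\<^sub>0" using h\<^sub>0(1) by (simp_all add: h\<^sub>1_def h\<^sub>2_def)
    obtain Q :: nat where Q: "h / (h\<^sub>2 - h) < real Q" using reals_Archimedean2 by blast
    define h\<^sub>3 where "h\<^sub>3 = h\<^sub>2 * real Q / (real Q + 1)"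
    have h3: "h < h\<^sub>3"
    proof -
      have "h < real Q * (h\<^sub>2 - h)" using Q hs(1) by (simp add: field_simps)
      then show ?thesis by (simp add: h\<^sub>3_def field_simps)
    qed
    define h\<^sub>4 where "h\<^sub>4 = (h + h\<^sub>3) / 2"
    have h4: "h < h\<^sub>4" "h\<^sub>4 < h\<^sub>3" using h3 by (simp_all add: h\<^sub>4_def)
    obtain \<delta> where \<delta>: "\<delta> > 0"
      "\<forall>N. \<exists>n\<ge>N. \<exists>E. finite E \<and> exp (h\<^sub>0 * real n) \<le> real (card E) \<and> spread T n \<delta> 0 E"
      by (rule entropy_imp_spread[OF h\<^sub>0(2)])
    obtain v where v: "rich T \<Phi> \<delta> 0 h\<^sub>1 v" by (rule rich_exists[OF M hs(3) \<delta>(2)[rule_format]])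
    obtain \<beta> where \<beta>: "\<beta> > 0" "rich T \<Phi> (\<delta> / 2) \<beta> h\<^sub>2 v"
      using rich_thin[OF assms(1) \<delta>(1) hs(2)] v by metis
    have d2: "\<delta> / 2 > 0" and d4: "\<delta> / 2 / 2 > 0" and d8: "\<delta> / 2 / 2 / 2 > 0" using \<delta>(1) by simp_all
    define mix where "mix q = (1 / (real Q + 1)) *\<^sub>R ((a, q) + real Q *\<^sub>R v)" for q
    have mix: "rich T \<Phi> (\<delta> / 2 / 2) 0 h\<^sub>3 (mix b)" "rich T \<Phi> (\<delta> / 2 / 2) 0 h\<^sub>3 (mix b')"
      unfolding mix_def h\<^sub>3_def
      by (rule rich_mix[OF assms(1) \<Phi> trc d2 \<beta> u], assumption)
        (rule rich_mix[OF assms(1) \<Phi> trc d2 \<beta> u'], assumption)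
    obtain \<beta>' where \<beta>': "\<beta>' > 0" "\<forall>v. rich T \<Phi> (\<delta> / 2 / 2) 0 h\<^sub>3 v \<longrightarrow> rich T \<Phi> (\<delta> / 2 / 2 / 2) \<beta>' h\<^sub>4 v"
      by (rule rich_thin[OF assms(1) d4 h4(2)])
    have mix_ne: "fst (mix b) = fst (mix b')" "snd (mix b) \<noteq> snd (mix b')"
      using b by (simp_all add: mix_def)
    have "bowen_C T ?Z s (\<delta> / 2 / 2 / 2 / 4) \<noteq> 0" if "0 \<le> s" "s < h\<^sub>4" for s
      by (rule bowen_C_nonzero_of_rich[OF assms(1,4,5) trc d8 \<beta>'(1)
            \<beta>'(2)[rule_format, OF mix(1), unfolded \<Phi>_def] \<beta>'(2)[rule_format, OF mix(2), unfolded \<Phi>_def] mix_ne that])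
    then have "ereal h\<^sub>4 \<le> top_entropy T ?Z"
      using \<delta>(1) by (intro top_entropy_geI[OF ne, of "\<delta> / 2 / 2 / 2 / 4"]) simp_all
    then have "ereal h\<^sub>4 < ereal h" using h(1) by (rule order_le_less_trans)
    then show False using h4(1) by simp
  qed
qed

end
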